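(* Let $\mathscr{A}$ be a $C^*$-algebra, $\mathscr{X}$ a Hilbert $\mathscr{A}$-module and $x,y\in\mathscr{X}$. The following are equivalent: (i) $x\perp_B^r y$, i.e. $\|x\|\le\|x+\alpha y\|$ for all $\alpha\in\mathbb{R}$; (ii) there exists $\varphi\in\Omega_x$ such that $\operatorname{Re}\varphi(\langle x,y\rangle)=0$.
   Context: A Hilbert $\mathscr{A}$-module is a right $\mathscr{A}$-module $\mathscr{X}$ with an $\mathscr{A}$-valued inner product $\langle\cdot,\cdot\rangle$, linear in the second variable and conjugate-linear in the first, with $\langle x,ya\rangle=\langle x,y\rangle a$, $\langle x,y\rangle^*=\langle y,x\rangle$, $\langle x,x\rangle\ge 0$ with equality iff $x=0$, complete for the norm $\|x\|=\|\langle x,x\rangle\|^{1/2}$. A state on $\mathscr{A}$ is a positive linear functional of norm one; $\mathcal{S}(\mathscr{A})$ denotes the set of states. For $x\in\mathscr{X}$, $\Omega_x:=\{\varphi\in\mathcal{S}(\mathscr{A}):\varphi(\langle x,x\rangle)=\|x\|^2\}$. *)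

theory Defs
  imports "HOL-Analysis.Analysis"
begin

class scaleC =
  fixes scaleC :: "complex \<Rightarrow> 'a \<Rightarrow> 'a" (infixr \<open>*\<^sub>C\<close> 75)

class complex_vector = scaleC + real_vector +
  assumes scaleC_add_right: "c *\<^sub>C (x + y) = c *\<^sub>C x + c *\<^sub>C y"
    and scaleC_add_left: "(c + d) *\<^sub>C x = c *\<^sub>C x + d *\<^sub>C x"
    and scaleC_scaleC: "c *\<^sub>C (d *\<^sub>C x) = (c * d) *\<^sub>C x"
    and scaleC_one: "1 *\<^sub>C x = x"
    and scaleR_scaleC: "r *\<^sub>R x = (complex_of_real r) *\<^sub>C x"

class complex_normed_vector = complex_vector + real_normed_vector +
  assumes norm_scaleC: "norm (c *\<^sub>C x) = cmod c * norm x"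

class cstar_algebra = complex_normed_vector + real_normed_algebra + banach +
  fixes cstar :: "'a \<Rightarrow> 'a"
  assumes scaleC_mult_left: "(c *\<^sub>C a) * b = c *\<^sub>C (a * b)"
    and scaleC_mult_right: "a * (c *\<^sub>C b) = c *\<^sub>C (a * b)"
    and cstar_cstar: "cstar (cstar a) = a"
    and cstar_add: "cstar (a + b) = cstar a + cstar b"
    and cstar_mult: "cstar (a * b) = cstar b * cstar a"
    and cstar_scaleC: "cstar (c *\<^sub>C a) = cnj c *\<^sub>C cstar a"
    and cstar_identity: "norm (cstar a * a) = (norm a)\<^sup>2"

definition positive :: "'a::cstar_algebra \<Rightarrow> bool" where
  "positive a \<longleftrightarrow> (\<exists>b. a = cstar b * b)"

definition hilbert_module ::
  "('x::{complex_normed_vector,banach} \<Rightarrow> 'a::cstar_algebra \<Rightarrow> 'x) \<Rightarrow> ('x \<Rightarrow> 'x \<Rightarrow> 'a) \<Rightarrow> bool" where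
  "hilbert_module rmul ip \<longleftrightarrow>
     (\<forall>x y a. rmul (x + y) a = rmul x a + rmul y a) \<and>
     (\<forall>x a b. rmul x (a + b) = rmul x a + rmul x b) \<and>
     (\<forall>x a b. rmul x (a * b) = rmul (rmul x a) b) \<and>
     (\<forall>c x a. c *\<^sub>C rmul x a = rmul (c *\<^sub>C x) a) \<and>
     (\<forall>c x a. c *\<^sub>C rmul x a = rmul x (c *\<^sub>C a)) \<and>
     (\<forall>x y z. ip x (y + z) = ip x y + ip x z) \<and>
     (\<forall>c x y. ip x (c *\<^sub>C y) = c *\<^sub>C ip x y) \<and>
     (\<forall>x y a. ip x (rmul y a) = ip x y * a) \<and>
     (\<forall>x y. cstar (ip x y) = ip y x) \<and>
     (\<forall>x. positive (ip x x)) \<and>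
     (\<forall>x. ip x x = 0 \<longleftrightarrow> x = 0) \<and>
     (\<forall>x. norm x = sqrt (norm (ip x x)))"

definition is_state :: "('a::cstar_algebra \<Rightarrow> complex) \<Rightarrow> bool" where
  "is_state \<phi> \<longleftrightarrow>
     (\<forall>a b. \<phi> (a + b) = \<phi> a + \<phi> b) \<and>
     (\<forall>c a. \<phi> (c *\<^sub>C a) = c * \<phi> a) \<and>
     (\<forall>a. positive a \<longrightarrow> Im (\<phi> a) = 0 \<and> Re (\<phi> a) \<ge> 0) \<and>
     bounded_linear \<phi> \<and> onorm \<phi> = 1"

definition states :: "('a::cstar_algebra \<Rightarrow> complex) set" where
  "states = {\<phi>. is_state \<phi>}"

definition Omega :: "('x::{complex_normed_vector,banach} \<Rightarrow> 'x \<Rightarrow> 'a::cstar_algebra) \<Rightarrow> 'x \<Rightarrow> ('a \<Rightarrow> complex) set" where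
  "Omega ip x = {\<phi> \<in> states. \<phi> (ip x x) = complex_of_real ((norm x)\<^sup>2)}"

definition birkhoff_orth_real :: "'x::real_normed_vector \<Rightarrow> 'x \<Rightarrow> bool" where
  "birkhoff_orth_real x y \<longleftrightarrow> (\<forall>\<alpha>::real. norm x \<le> norm (x + \<alpha> *\<^sub>R y))"

end

theory Submission
  imports Defs
begin

text \<open>
  Expanding \<open>\<langle>x + r y, x + r y\<rangle>\<close> turns orthogonality of \<open>x\<close> and \<open>y\<close> into \<open>\<parallel>a\<parallel> \<le> \<parallel>a + r h\<parallel>\<close> for all real \<open>r\<close>,
  where \<open>a = \<langle>x, x\<rangle>\<close> and \<open>h = \<langle>x, y\<rangle> + \<langle>y, x\<rangle>\<close>; the quadratic term disappears by convexity of the norm.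
  Hahn-Banach then yields a real functional of norm one that attains its norm at \<open>a\<close> and
  vanishes at \<open>h\<close>. Made hermitian and complexified it is a state: a functional that attains its
  norm at a positive element is positive, because \<open>\<parallel>a - p\<parallel> \<le> 1\<close> for positive \<open>a\<close>, \<open>p\<close> of norm at most one.
  This last inequality rests on the positivity of \<open>b\<^sup>* b\<close> in the unitization, obtained without
  spectral theory from the binomial series for the square root and from the fact that a
  unitary has norm one.
\<close>

section \<open>The unitization\<close>

lemma scaleC_zero_right [simp]: "c *\<^sub>C (0::'a::complex_vector) = 0"
  by (metis add_cancel_right_right scaleC_add_right)

lemma scaleC_zero_left [simp]: "0 *\<^sub>C (x::'a::complex_vector) = 0"
  by (metis add_cancel_right_right scaleC_add_left)

lemma scaleC_minus_right [simp]: "c *\<^sub>C (- x) = - (c *\<^sub>C (x::'a::complex_vector))"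
  by (metis add.right_inverse minus_unique scaleC_add_right scaleC_zero_right)

lemma scaleC_minus_left [simp]: "(- c) *\<^sub>C x = - (c *\<^sub>C (x::'a::complex_vector))"
  by (metis add.right_inverse minus_unique scaleC_add_left scaleC_zero_left)

lemma scaleC_diff_right: "c *\<^sub>C (x - y) = c *\<^sub>C x - c *\<^sub>C (y::'a::complex_vector)"
  using scaleC_add_right[of c x "- y"] by simp

lemma scaleC_scaleR: "c *\<^sub>C (r *\<^sub>R x) = r *\<^sub>R (c *\<^sub>C (x::'a::complex_vector))"
  by (simp add: scaleR_scaleC scaleC_scaleC mult.commute)

lemma bounded_linear_scaleC: "bounded_linear (\<lambda>x::'a::complex_normed_vector. c *\<^sub>C x)"
  by (rule bounded_linear_intro[where K = "cmod c"])
     (simp_all add: scaleC_add_right scaleC_scaleR norm_scaleC mult.commute)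

lemma cstar_zero [simp]: "cstar 0 = (0::'a::cstar_algebra)"
  by (metis add_cancel_right_right cstar_add)

lemma cstar_minus [simp]: "cstar (- x) = - cstar (x::'a::cstar_algebra)"
  by (metis add.right_inverse minus_unique cstar_add cstar_zero)

lemma cstar_diff: "cstar (x - y) = cstar x - cstar (y::'a::cstar_algebra)"
  using cstar_add[of x "- y"] by simp

lemma cstar_scaleR: "cstar (r *\<^sub>R x) = r *\<^sub>R cstar (x::'a::cstar_algebra)"
  by (simp add: scaleR_scaleC cstar_scaleC)

text \<open>The C*-identity and submultiplicativity allow one factor \<open>norm x\<close> to be
  cancelled. Applied to \<open>cstar x\<close> as well, the bound makes the involution
  isometric.\<close>

lemma norm_cstar_le: "norm (x::'a::cstar_algebra) \<le> norm (cstar x)"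
proof (cases "x = 0")
  case False
  have "norm x * norm x \<le> norm (cstar x) * norm x"
    using norm_mult_ineq[of "cstar x" x] cstar_identity[of x] by (simp add: power2_eq_square)
  with False show ?thesis by simp
qed simp

lemma norm_cstar [simp]: "norm (cstar x) = norm (x::'a::cstar_algebra)"
  using norm_cstar_le[of x] norm_cstar_le[of "cstar x"] by (simp add: cstar_cstar)

lemma bounded_linear_cstar: "bounded_linear (cstar :: 'a::cstar_algebra \<Rightarrow> 'a)"
  by (rule bounded_linear_intro[where K = 1]) (simp_all add: cstar_add cstar_scaleR)

lemma cstar_mult_self_eq_0: "cstar x * x = 0 \<longleftrightarrow> x = (0::'a::cstar_algebra)"
  using cstar_identity[of x] by auto

section \<open>Adjoining a unit\<close>

datatype 'a unitization = Unitization (body: 'a) (scal: complex)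

text \<open>\<open>Unitization b c\<close> stands for the formal sum of \<open>b\<close> and
  \<open>c\<close> times the new unit; multiplying out two such sums gives the product.\<close>

instantiation unitization :: (cstar_algebra) ring_1
begin
definition "0 = Unitization 0 0"
definition "1 = Unitization 0 1"
definition "v + w = Unitization (body v + body w) (scal v + scal w)"
definition "v - w = Unitization (body v - body w) (scal v - scal w)"
definition "- v = Unitization (- body v) (- scal v)"
definition "v * w = Unitization (scal v *\<^sub>C body w + scal w *\<^sub>C body v + body v * body w) (scal v * scal w)"

lemmas unitization_ops = zero_unitization_def one_unitization_def plus_unitization_def
  minus_unitization_def uminus_unitization_def times_unitization_def

instance
  by standard (simp_all add: unitization_ops algebra_simps scaleC_add_right scaleC_add_left
    scaleC_scaleC scaleC_one scaleC_mult_left scaleC_mult_right)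
end

instantiation unitization :: (cstar_algebra) "{real_algebra_1, complex_vector}"
begin
definition "r *\<^sub>R v = Unitization (r *\<^sub>R body v) (r *\<^sub>R scal v)"
definition "c *\<^sub>C v = Unitization (c *\<^sub>C body v) (c * scal v)"

instance
proof
  fix v w :: "'a unitization" and r s :: real and c d :: complex
  show "r *\<^sub>R (v + w) = r *\<^sub>R v + r *\<^sub>R w" "(r + s) *\<^sub>R v = r *\<^sub>R v + s *\<^sub>R v"
    "r *\<^sub>R s *\<^sub>R v = (r * s) *\<^sub>R v" "1 *\<^sub>R v = v"
    by (simp_all add: unitization_ops scaleR_unitization_def scaleR_add_right scaleR_add_left)
  show "r *\<^sub>R v * w = r *\<^sub>R (v * w)" "v * r *\<^sub>R w = r *\<^sub>R (v * w)"
    by (simp_all add: unitization_ops scaleR_unitization_def scaleR_scaleC scaleC_scaleC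
      scaleC_add_right scaleC_mult_left scaleC_mult_right scaleR_conv_of_real mult.commute)
  show "c *\<^sub>C (v + w) = c *\<^sub>C v + c *\<^sub>C w" "(c + d) *\<^sub>C v = c *\<^sub>C v + d *\<^sub>C v"
    "c *\<^sub>C d *\<^sub>C v = (c * d) *\<^sub>C v" "1 *\<^sub>C v = v"
    by (simp_all add: unitization_ops scaleC_unitization_def scaleC_add_right scaleC_add_left
      scaleC_scaleC scaleC_one algebra_simps)
  show "r *\<^sub>R v = complex_of_real r *\<^sub>C v"
    by (simp add: scaleR_unitization_def scaleC_unitization_def scaleR_scaleC scaleR_conv_of_real)
qed
end

text \<open>The original algebra is an ideal of its unitization, and this is left multiplication by
  \<open>w\<close> on that ideal. Its operator norm enters the norm of \<open>w\<close>.\<close>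

definition act :: "'a::cstar_algebra unitization \<Rightarrow> 'a \<Rightarrow> 'a" where
  "act w z = scal w *\<^sub>C z + body w * z"

lemma bounded_linear_act: "bounded_linear (act w)"
  unfolding act_def
  by (intro bounded_linear_add bounded_linear_scaleC bounded_linear_mult_right)

lemma act_mult: "act (v * w) = act v \<circ> act w"
  by (simp add: fun_eq_iff act_def times_unitization_def algebra_simps scaleC_add_right
    scaleC_scaleC scaleC_mult_left scaleC_mult_right)

lemma act_add: "act (v + w) = (\<lambda>z. act v z + act w z)"
  by (simp add: fun_eq_iff act_def plus_unitization_def algebra_simps scaleC_add_left)

lemma act_scaleR: "act (r *\<^sub>R v) = (\<lambda>z. r *\<^sub>R act v z)"
  by (simp add: fun_eq_iff act_def scaleR_unitization_def scaleR_scaleC scaleC_scaleC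
    scaleC_add_right scaleC_mult_left scaleR_conv_of_real)

lemma act_one: "act 1 = (\<lambda>z. z)"
  by (simp add: fun_eq_iff act_def one_unitization_def scaleC_one)

lemma norm_act_le: "norm (act w z) \<le> onorm (act w) * norm z"
  by (rule onorm[OF bounded_linear_act])

text \<open>By the C*-identity, left multiplication by \<open>a\<close> attains its norm at
  \<open>cstar a\<close>. Hence the algebra embeds isometrically into its unitization.\<close>

lemma onorm_left_mult: "onorm (\<lambda>z. a * z) = norm (a::'a::cstar_algebra)"
proof (rule antisym)
  show "onorm (\<lambda>z. a * z) \<le> norm a"
    by (rule onorm_bound) (simp_all add: norm_mult_ineq)
  have "norm a * norm a = norm (a * cstar a)"
    using cstar_identity[of "cstar a"] by (simp add: cstar_cstar power2_eq_square)
  also have "\<dots> \<le> onorm (\<lambda>z. a * z) * norm a"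
    using onorm[OF bounded_linear_mult_right[of a], of "cstar a"] by simp
  finally show "norm a \<le> onorm (\<lambda>z. a * z)"
    using onorm_pos_le[OF bounded_linear_mult_right[of a]] by (cases "a = 0") auto
qed

text \<open>The usual operator norm alone would only be a seminorm if the algebra already has a unit;
  taking the maximum with the modulus of the scalar part avoids that case distinction.\<close>

instantiation unitization :: (cstar_algebra) real_normed_algebra_1
begin
definition "norm w = max (cmod (scal w)) (onorm (act w))"
definition "dist v w = norm (v - w :: 'a unitization)"
definition "sgn w = w /\<^sub>R norm (w :: 'a unitization)"
definition "uniformity = (INF e\<in>{0<..}. principal {(v :: 'a unitization, w). dist v w < e})"
definition "open U = (\<forall>v\<in>U. eventually (\<lambda>(v', w :: 'a unitization). v' = v \<longrightarrow> w \<in> U) uniformity)"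

instance
proof
  fix v w :: "'a unitization" and r :: real
  show "(norm v = 0) = (v = 0)"
  proof
    assume n: "norm v = 0"
    have "cmod (scal v) \<le> 0" "onorm (act v) \<le> 0"
      using n unfolding norm_unitization_def by linarith+
    then have s: "scal v = 0" and o: "onorm (act v) = 0"
      using onorm_pos_le[OF bounded_linear_act[of v]] by auto
    have "act v = (\<lambda>z. body v * z)" by (simp add: s act_def fun_eq_iff)
    with o have "body v = 0" by (simp add: onorm_left_mult)
    with s show "v = 0" by (cases v) (simp add: zero_unitization_def)
  next
    assume "v = 0"
    then have "act v = (\<lambda>z. 0)" by (simp add: act_def zero_unitization_def fun_eq_iff)
    then show "norm v = 0" using \<open>v = 0\<close>
      by (simp add: norm_unitization_def zero_unitization_def onorm_zero)
  qed
  have "onorm (act (v + w)) \<le> onorm (act v) + onorm (act w)"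
    unfolding act_add by (intro onorm_triangle bounded_linear_act)
  moreover have "cmod (scal (v + w)) \<le> cmod (scal v) + cmod (scal w)"
    by (simp add: plus_unitization_def norm_triangle_ineq)
  ultimately show "norm (v + w) \<le> norm v + norm w"
    unfolding norm_unitization_def by linarith
  have "cmod (scal (r *\<^sub>R v)) = \<bar>r\<bar> * cmod (scal v)"
    by (simp add: scaleR_unitization_def)
  then show "norm (r *\<^sub>R v) = \<bar>r\<bar> * norm v"
    by (simp add: norm_unitization_def act_scaleR onorm_scaleR[OF bounded_linear_act]
      max_mult_distrib_left)
  have "onorm (act (v * w)) \<le> onorm (act v) * onorm (act w)"
    unfolding act_mult by (intro onorm_compose bounded_linear_act)
  also have "\<dots> \<le> norm v * norm w"
    unfolding norm_unitization_def
    by (intro mult_mono) (auto simp: onorm_pos_le bounded_linear_act le_max_iff_disj)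
  finally have "onorm (act (v * w)) \<le> norm v * norm w" .
  moreover have "cmod (scal (v * w)) \<le> norm v * norm w"
    unfolding norm_unitization_def times_unitization_def by (simp add: norm_mult mult_mono le_max_iff_disj)
  ultimately show "norm (v * w) \<le> norm v * norm w"
    by (simp add: norm_unitization_def[of "v * w"])
  have "onorm (\<lambda>z::'a. z) \<le> 1" by (rule onorm_bound) simp_all
  then show "norm (1 :: 'a unitization) = 1"
    by (simp add: norm_unitization_def act_one) (simp add: one_unitization_def)
qed (rule dist_unitization_def sgn_unitization_def uniformity_unitization_def open_unitization_def)+
end

lemma norm_scal_le: "cmod (scal w) \<le> norm w"
  by (simp add: norm_unitization_def)

lemma onorm_act_le: "onorm (act w) \<le> norm w"
  by (simp add: norm_unitization_def)

lemma norm_unitization_le: "norm w \<le> cmod (scal w) + norm (body w)"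
proof -
  have "norm (act w z) \<le> (cmod (scal w) + norm (body w)) * norm z" for z
    unfolding act_def
    by (rule order_trans[OF norm_triangle_ineq])
       (simp add: norm_scaleC distrib_right norm_mult_ineq)
  then show ?thesis
    by (simp add: norm_unitization_def onorm_bound)
qed

text \<open>Removing the scalar part from \<open>act w\<close> leaves left multiplication by
  \<open>body w\<close>. With \<open>norm_unitization_le\<close>, the norm is equivalent to the sum
  of the component norms, so completeness can be checked componentwise.\<close>

lemma norm_body_le: "norm (body (w :: 'a::cstar_algebra unitization)) \<le> 2 * norm w"
proof -
  have eq: "(\<lambda>z. body w * z) = (\<lambda>z. act w z + (- scal w) *\<^sub>C z)"
    by (simp add: act_def fun_eq_iff)
  have "onorm (\<lambda>z::'a. (- scal w) *\<^sub>C z) \<le> cmod (scal w)"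
    by (rule onorm_bound) (simp_all add: norm_scaleC)
  moreover have "norm (body w) \<le> onorm (act w) + onorm (\<lambda>z::'a. (- scal w) *\<^sub>C z)"
    unfolding onorm_left_mult[of "body w", symmetric] eq
    by (rule onorm_triangle[OF bounded_linear_act[of w] bounded_linear_scaleC[of "- scal w"]])
  ultimately show ?thesis
    using norm_scal_le[of w] onorm_act_le[of w] by linarith
qed

instance unitization :: (cstar_algebra) banach
proof
  fix X :: "nat \<Rightarrow> 'a unitization" assume C: "Cauchy X"
  have "Cauchy (\<lambda>n. scal (X n))"
  proof (rule metric_CauchyI)
    fix e :: real assume "e > 0"
    then obtain M where "\<forall>m\<ge>M. \<forall>n\<ge>M. dist (X m) (X n) < e"
      using C by (meson metric_CauchyD)
    moreover have "dist (scal v) (scal w) \<le> dist v w" for v w :: "'a unitization"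
      using norm_scal_le[of "v - w"] by (simp add: dist_norm minus_unitization_def)
    ultimately show "\<exists>M. \<forall>m\<ge>M. \<forall>n\<ge>M. dist (scal (X m)) (scal (X n)) < e"
      by (meson le_less_trans)
  qed
  then obtain l where l: "(\<lambda>n. scal (X n)) \<longlonglongrightarrow> l"
    by (meson Cauchy_convergent convergent_def)
  have "Cauchy (\<lambda>n. body (X n))"
  proof (rule metric_CauchyI)
    fix e :: real assume "e > 0"
    then obtain M where "\<forall>m\<ge>M. \<forall>n\<ge>M. dist (X m) (X n) < e / 2"
      using C by (meson metric_CauchyD half_gt_zero)
    moreover have "dist (body v) (body w) \<le> 2 * dist v w" for v w :: "'a unitization"
      using norm_body_le[of "v - w"] by (simp add: dist_norm minus_unitization_def)
    ultimately show "\<exists>M. \<forall>m\<ge>M. \<forall>n\<ge>M. dist (body (X m)) (body (X n)) < e"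
      by (smt (verit, best) field_sum_of_halves)
  qed
  then obtain b where b: "(\<lambda>n. body (X n)) \<longlonglongrightarrow> b"
    by (meson Cauchy_convergent convergent_def)
  have "(\<lambda>n. cmod (scal (X n) - l) + norm (body (X n) - b)) \<longlonglongrightarrow> 0"
    using tendsto_add[OF tendsto_norm[OF LIM_zero[OF l]] tendsto_norm[OF LIM_zero[OF b]]] by simp
  then have "(\<lambda>n. X n - Unitization b l) \<longlonglongrightarrow> 0"
    by (rule Lim_null_comparison[rotated])
       (use norm_unitization_le[of "X _ - Unitization b l"] in \<open>auto simp: minus_unitization_def\<close>)
  then show "convergent X"
    by (rule convergentI[OF LIM_zero_cancel])
qed

instantiation unitization :: (cstar_algebra) cstar_algebra
begin
definition "cstar w = Unitization (cstar (body w)) (cnj (scal w))"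

text \<open>Combined with the C*-identity of the original algebra, this bounds the square of
  \<open>norm (act w z)\<close> by \<open>norm (cstar w * w)\<close> times the square of
  \<open>norm z\<close>.\<close>

lemma cstar_act_mult_act: "cstar (act w z) * act w z = cstar z * act (cstar w * w) z"
  by (simp add: act_def cstar_unitization_def times_unitization_def cstar_add cstar_scaleC cstar_mult
    algebra_simps scaleC_add_right scaleC_scaleC scaleC_mult_left scaleC_mult_right)

instance
proof
  fix v w :: "'a unitization" and c :: complex
  show "norm (c *\<^sub>C v) = cmod c * norm v"
  proof -
    have le: "norm (c *\<^sub>C v) \<le> cmod c * norm v" for c and v :: "'a unitization"
    proof -
      have act: "act (c *\<^sub>C v) z = c *\<^sub>C act v z" for z
        by (simp add: act_def scaleC_unitization_def scaleC_scaleC scaleC_add_right scaleC_mult_left)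
      have "norm (act (c *\<^sub>C v) z) \<le> (cmod c * norm v) * norm z" for z
        using mult_left_mono[OF order_trans[OF norm_act_le mult_right_mono[OF onorm_act_le]],
            of z "cmod c" v]
        by (simp add: act norm_scaleC mult.assoc)
      then have "onorm (act (c *\<^sub>C v)) \<le> cmod c * norm v"
        by (intro onorm_bound) simp_all
      moreover have "cmod (scal (c *\<^sub>C v)) \<le> cmod c * norm v"
        by (simp add: scaleC_unitization_def norm_mult mult_left_mono norm_scal_le)
      ultimately show ?thesis by (simp add: norm_unitization_def)
    qed
    show ?thesis
    proof (cases "c = 0")
      case False
      \<comment> \<open>The reverse inequality follows by scaling back with
        \<open>inverse c\<close>.\<close>
      have "norm v = norm (inverse c *\<^sub>C c *\<^sub>C v)"
        using False by (simp add: scaleC_scaleC scaleC_one)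
      also have "\<dots> \<le> norm (c *\<^sub>C v) / cmod c"
        using le[of "inverse c" "c *\<^sub>C v"] by (simp add: norm_inverse divide_inverse mult.commute)
      finally show ?thesis using le[of c v] False by (simp add: field_simps)
    qed simp
  qed
  show "norm (cstar v * v) = (norm v)\<^sup>2"
  proof -
    have le: "(norm w)\<^sup>2 \<le> norm (cstar w * w)" for w :: "'a unitization"
    proof -
      have "norm (act w z) \<le> sqrt (norm (cstar w * w)) * norm z" for z
      proof -
        have "(norm (act w z))\<^sup>2 = norm (cstar z * act (cstar w * w) z)"
          by (metis cstar_identity cstar_act_mult_act)
        also have "\<dots> \<le> norm z * norm (act (cstar w * w) z)"
          using norm_mult_ineq[of "cstar z" "act (cstar w * w) z"] by simp
        also have "\<dots> \<le> norm z * (norm (cstar w * w) * norm z)"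
          by (intro mult_left_mono order_trans[OF norm_act_le mult_right_mono[OF onorm_act_le]]) auto
        also have "\<dots> = (sqrt (norm (cstar w * w)) * norm z)\<^sup>2"
          by (simp add: power_mult_distrib power2_eq_square)
        finally show ?thesis by (rule power2_le_imp_le) simp
      qed
      then have "onorm (act w) \<le> sqrt (norm (cstar w * w))"
        by (intro onorm_bound) simp_all
      moreover have "cmod (scal w) \<le> sqrt (norm (cstar w * w))"
        using norm_scal_le[of "cstar w * w"]
        by (intro real_le_rsqrt)
           (simp add: times_unitization_def cstar_unitization_def norm_mult power2_eq_square)
      ultimately have "norm w \<le> sqrt (norm (cstar w * w))"
        by (simp add: norm_unitization_def)
      then show ?thesis
        by (metis norm_ge_zero power_mono real_sqrt_pow2)
    qed
    \<comment> \<open>Cancelling one factor \<open>norm w\<close> in \<open>le\<close> shows that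
      the involution is isometric; submultiplicativity then reverses \<open>le\<close>.\<close>
    have le_star: "norm w \<le> norm (cstar w)" for w :: "'a unitization"
      using order_trans[OF le[of w] norm_mult_ineq]
      by (cases "w = 0") (auto simp: power2_eq_square)
    have "cstar (cstar v) = v"
      by (cases v) (simp add: cstar_unitization_def cstar_cstar)
    then have "norm (cstar v) = norm v"
      using le_star[of v] le_star[of "cstar v"] by simp
    then show ?thesis
      using le[of v] norm_mult_ineq[of "cstar v" v] by (simp add: power2_eq_square)
  qed
  show "c *\<^sub>C v * w = c *\<^sub>C (v * w)" "v * c *\<^sub>C w = c *\<^sub>C (v * w)"
    by (simp_all add: scaleC_unitization_def times_unitization_def scaleC_add_right scaleC_scaleC
      scaleC_mult_left scaleC_mult_right mult.commute mult.left_commute[where 'a = complex])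
  show "cstar (cstar v) = v"
    by (simp add: cstar_unitization_def cstar_cstar)
  show "cstar (v + w) = cstar v + cstar w"
    by (simp add: cstar_unitization_def plus_unitization_def cstar_add)
  show "cstar (v * w) = cstar w * cstar v"
    by (simp add: cstar_unitization_def times_unitization_def cstar_add cstar_mult cstar_scaleC
      mult.commute[where 'a = complex])
  show "cstar (c *\<^sub>C v) = cnj c *\<^sub>C cstar v"
    by (simp add: cstar_unitization_def scaleC_unitization_def cstar_scaleC)
qed
end

lemma norm_Unitization_0: "norm (Unitization a 0) = norm (a::'a::cstar_algebra)"
proof -
  have "act (Unitization a 0) = (\<lambda>z. a * z)" by (simp add: act_def fun_eq_iff)
  then show ?thesis by (simp add: norm_unitization_def onorm_left_mult)
qed

section \<open>Square roots and positive elements\<close>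

text \<open>The recursion compares coefficients in \<open>f * f = 2 * f - w\<close> for
  \<open>f = 1 - sqrt (1 - w)\<close>. Since the constant coefficient is 0, both end terms of the
  convolution drop out.\<close>

fun sqrt_coeff :: "nat \<Rightarrow> real" where
  "sqrt_coeff 0 = 0"
| "sqrt_coeff (Suc n) =
     ((if n = 0 then 1 else 0) + (\<Sum>i\<in>{1..n}. sqrt_coeff i * sqrt_coeff (Suc n - i))) / 2"

lemma sqrt_coeff_nonneg: "0 \<le> sqrt_coeff n"
  by (induction n rule: sqrt_coeff.induct) (auto intro!: sum_nonneg mult_nonneg_nonneg)

lemma sqrt_coeff_convolution:
  "(\<Sum>i\<le>n. sqrt_coeff i * sqrt_coeff (n - i)) = 2 * sqrt_coeff n - (if n = 1 then 1 else 0)"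
proof (cases n)
  case (Suc m)
  have "(\<Sum>i\<le>n. sqrt_coeff i * sqrt_coeff (n - i)) = (\<Sum>i\<in>{1..m}. sqrt_coeff i * sqrt_coeff (n - i))"
    by (rule sum.mono_neutral_right) (auto simp: Suc not_le less_Suc_eq_le antisym_conv Suc_le_eq elim!: le_SucE)
  then show ?thesis by (simp add: Suc)
qed simp

text \<open>If \<open>s\<close> is the partial sum up to \<open>N\<close> and \<open>s'\<close> the
  next one, then \<open>2 * s' - 1 \<le> s * s \<le> 1\<close>, hence
  \<open>s' \<le> 1\<close>.\<close>

lemma sum_sqrt_coeff_le: "(\<Sum>n\<le>N. sqrt_coeff n) \<le> 1"
proof (induction N)
  case (Suc N)
  let ?c = sqrt_coeff and ?B = "{(i, j). i + j \<le> Suc N}"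
  have nz: "1 \<le> i" if "?c i \<noteq> 0" for i
    using that by (cases i) auto
  have fin: "finite ?B" by (rule finite_subset[of _ "{..Suc N} \<times> {..Suc N}"]) auto
  have "2 * (\<Sum>n\<le>Suc N. ?c n) - 1 = (\<Sum>n\<le>Suc N. \<Sum>i\<le>n. ?c i * ?c (n - i))"
    by (simp only: sqrt_coeff_convolution sum_subtractf sum_distrib_left) simp
  also have "\<dots> = (\<Sum>(i, j)\<in>?B. ?c i * ?c j)"
    by (rule sum.triangle_reindex_eq[symmetric])
  \<comment> \<open>Only pairs of positive indices contribute, and each index of such a pair is at
    most \<open>N\<close>.\<close>
  also have "\<dots> = (\<Sum>(i, j)\<in>?B \<inter> {..N} \<times> {..N}. ?c i * ?c j)"
    by (rule sum.mono_neutral_right[OF fin]) (auto dest!: nz)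
  also have "\<dots> \<le> (\<Sum>(i, j)\<in>{..N} \<times> {..N}. ?c i * ?c j)"
    by (rule sum_mono2) (auto simp: sqrt_coeff_nonneg)
  also have "\<dots> = (\<Sum>i\<le>N. ?c i) * (\<Sum>i\<le>N. ?c i)"
    by (simp only: sum_product sum.cartesian_product)
  also have "\<dots> \<le> 1"
    using mult_mono[OF Suc Suc] by (simp add: sum_nonneg sqrt_coeff_nonneg)
  finally show ?case by (simp del: sqrt_coeff.simps)
qed simp

lemma summable_sqrt_coeff: "summable sqrt_coeff"
  by (rule bounded_imp_summable[where B = 1]) (auto simp: sqrt_coeff_nonneg sum_sqrt_coeff_le)

text \<open>The binomial series of \<open>1 - sqrt (1 - w)\<close>; its coefficients are non-negative with sum at
  most 1, so it still converges on the unit sphere.\<close>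

definition sqrt_series :: "'a::{real_normed_algebra_1, banach} \<Rightarrow> 'a" where
  "sqrt_series w = (\<Sum>n. sqrt_coeff n *\<^sub>R w ^ n)"

lemma norm_sqrt_series_term:
  fixes w :: "'a::{real_normed_algebra_1, banach}"
  assumes "norm w \<le> 1"
  shows "norm (sqrt_coeff n *\<^sub>R w ^ n) \<le> sqrt_coeff n"
proof -
  have "norm (w ^ n) \<le> 1"
    using norm_power_ineq[of w n] power_le_one[of "norm w" n] assms by simp
  then show ?thesis
    using mult_left_mono[of "norm (w ^ n)" 1 "sqrt_coeff n"] by (simp add: sqrt_coeff_nonneg)
qed

lemma
  fixes w :: "'a::{real_normed_algebra_1, banach}"
  assumes "norm w \<le> 1"
  shows summable_norm_sqrt_series: "summable (\<lambda>n. norm (sqrt_coeff n *\<^sub>R w ^ n))"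
    and summable_sqrt_series: "summable (\<lambda>n. sqrt_coeff n *\<^sub>R w ^ n)"
proof -
  show "summable (\<lambda>n. norm (sqrt_coeff n *\<^sub>R w ^ n))"
    by (rule summable_comparison_test'[OF summable_sqrt_coeff, where N = 0])
       (use norm_sqrt_series_term[OF assms] in simp)
  then show "summable (\<lambda>n. sqrt_coeff n *\<^sub>R w ^ n)"
    by (rule summable_norm_cancel)
qed

lemma norm_sqrt_series_le:
  fixes w :: "'a::{real_normed_algebra_1, banach}"
  assumes "norm w \<le> 1"
  shows "norm (sqrt_series w) \<le> 1"
proof -
  have "norm (sqrt_series w) \<le> (\<Sum>n. sqrt_coeff n)"
    unfolding sqrt_series_def
    by (rule norm_suminf_le[OF norm_sqrt_series_term[OF assms] summable_sqrt_coeff])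
  also have "\<dots> \<le> 1"
    by (rule suminf_le_const[OF summable_sqrt_coeff])
       (metis lessThan_Suc_atMost order_trans sum_sqrt_coeff_le sum_mono2 finite_atMost
          lessThan_subset_iff sqrt_coeff_nonneg le_SucI order_refl)
  finally show ?thesis .
qed

lemma sqrt_series_mult_self:
  fixes w :: "'a::{real_normed_algebra_1, banach}"
  assumes "norm w \<le> 1"
  shows "sqrt_series w * sqrt_series w = 2 *\<^sub>R sqrt_series w - w"
proof -
  let ?t = "\<lambda>n. sqrt_coeff n *\<^sub>R w ^ n"
  have "(\<Sum>i\<le>n. ?t i * ?t (n - i)) = 2 *\<^sub>R ?t n - (if n = 1 then w else 0)" for n
  proof -
    have "(\<Sum>i\<le>n. ?t i * ?t (n - i)) = (\<Sum>i\<le>n. sqrt_coeff i * sqrt_coeff (n - i)) *\<^sub>R w ^ n"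
      unfolding scaleR_sum_left by (rule sum.cong) (auto simp flip: power_add)
    then show ?thesis
      by (simp only: sqrt_coeff_convolution) (simp add: scaleR_diff_left)
  qed
  then have "sqrt_series w * sqrt_series w = (\<Sum>n. 2 *\<^sub>R ?t n - (if n = 1 then w else 0))"
    unfolding sqrt_series_def
    using Cauchy_product[OF summable_norm_sqrt_series summable_norm_sqrt_series, OF assms assms]
    by simp
  also have "\<dots> = 2 *\<^sub>R sqrt_series w - w"
    unfolding sqrt_series_def
    by (rule sums_unique[symmetric], intro sums_diff sums_scaleR_right summable_sums summable_sqrt_series assms)
       (use sums_single[of 1 "\<lambda>_. w"] in simp)
  finally show ?thesis .
qed

lemma one_minus_sqrt_series_square:
  fixes w :: "'a::{real_normed_algebra_1, banach}"
  assumes "norm w \<le> 1"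
  shows "(1 - sqrt_series w) * (1 - sqrt_series w) = 1 - w"
  using sqrt_series_mult_self[OF assms] by (simp add: algebra_simps scaleR_2)

text \<open>The relation passes to powers and then termwise to the series. For \<open>w' = w\<close>
  it says that the series commutes with whatever commutes with \<open>w\<close>.\<close>

lemma sqrt_series_intertwine:
  fixes w :: "'a::{real_normed_algebra_1, banach}"
  assumes "norm w \<le> 1" "norm w' \<le> 1" and eq: "z * w = w' * z"
  shows "z * sqrt_series w = sqrt_series w' * z"
proof -
  have pow: "z * w ^ n = w' ^ n * z" for n
    by (induction n) (simp, simp add: power_Suc2 flip: mult.assoc, simp add: mult.assoc eq power_commutes)
  have "z * sqrt_series w = (\<Sum>n. z * (sqrt_coeff n *\<^sub>R w ^ n))"
    unfolding sqrt_series_def by (rule suminf_mult[symmetric, OF summable_sqrt_series[OF assms(1)]])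
  also have "\<dots> = (\<Sum>n. (sqrt_coeff n *\<^sub>R w' ^ n) * z)"
    by (simp add: pow)
  also have "\<dots> = sqrt_series w' * z"
    unfolding sqrt_series_def by (rule suminf_mult2[symmetric, OF summable_sqrt_series[OF assms(2)]])
  finally show ?thesis .
qed

section \<open>Norm bounds from unitary elements\<close>

lemma cstar_one [simp]: "cstar 1 = (1 :: 'a::{cstar_algebra, real_normed_algebra_1})"
  by (metis cstar_cstar cstar_mult mult.right_neutral mult.left_neutral)

lemma cstar_power: "cstar (w ^ n) = cstar w ^ n" for w :: "'a::{cstar_algebra, real_normed_algebra_1}"
  by (induction n) (simp_all add: cstar_mult power_commutes)

lemma cstar_sqrt_series:
  fixes w :: "'a::{cstar_algebra, real_normed_algebra_1}"
  assumes "norm w \<le> 1"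
  shows "cstar (sqrt_series w) = sqrt_series (cstar w)"
  unfolding sqrt_series_def
  by (simp add: bounded_linear.suminf[OF bounded_linear_cstar summable_sqrt_series[OF assms]]
      cstar_scaleR cstar_power)

lemma norm_square_selfadjoint:
  "cstar k = k \<Longrightarrow> norm (k * k) = (norm k)\<^sup>2" for k :: "'a::cstar_algebra"
  using cstar_identity[of k] by simp

text \<open>The element \<open>d + i e\<close> is unitary.\<close>

lemma norm_le_1_if_sum_squares_eq_1:
  fixes d e :: "'a::{cstar_algebra, real_normed_algebra_1}"
  assumes d: "cstar d = d" and e: "cstar e = e" and com: "d * e = e * d" and sq: "d * d + e * e = 1"
  shows "norm d \<le> 1"
proof -
  define u where "u = d + \<i> *\<^sub>C e"
  have cu: "cstar u = d - \<i> *\<^sub>C e"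
    by (simp add: u_def cstar_add cstar_scaleC d e)
  have "cstar u * u = d * d + e * e"
    unfolding cu unfolding u_def
    by (simp add: algebra_simps scaleC_mult_left scaleC_mult_right com scaleC_scaleC scaleC_one
        scaleC_diff_right)
  then have "(norm u)\<^sup>2 = 1"
    using cstar_identity[of u] sq by simp
  then have "norm u = 1" using norm_ge_zero[of u] by (auto simp: power2_eq_1_iff)
  moreover have "2 *\<^sub>R d = u + cstar u"
    unfolding cu by (simp add: u_def scaleR_2)
  then have "norm (2 *\<^sub>R d) \<le> norm u + norm (cstar u)"
    by (metis norm_triangle_ineq)
  ultimately show ?thesis by simp
qed

text \<open>The root \<open>s\<close> of \<open>1 - k * k\<close> commutes with \<open>k\<close> and
  satisfies \<open>s * s + k * k = 1\<close>, so it is the real part of a unitary and has norm at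
  most 1; then square.\<close>

lemma norm_one_minus_square_le:
  fixes k :: "'a::{cstar_algebra, real_normed_algebra_1}"
  assumes k: "cstar k = k" and le: "norm k \<le> 1"
  shows "norm (1 - k * k) \<le> 1"
proof -
  define s where "s = 1 - sqrt_series (k * k)"
  have n: "norm (k * k) \<le> 1"
    using le by (simp add: norm_square_selfadjoint[OF k] power_le_one)
  have ss: "s * s = 1 - k * k"
    unfolding s_def by (rule one_minus_sqrt_series_square[OF n])
  have cs: "cstar s = s"
    by (simp add: s_def cstar_diff cstar_sqrt_series[OF n] cstar_mult k)
  have "k * sqrt_series (k * k) = sqrt_series (k * k) * k"
    by (rule sqrt_series_intertwine[OF n n]) (simp add: mult.assoc)
  then have "s * k = k * s"
    by (simp add: s_def algebra_simps)
  then have "norm s \<le> 1"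
    by (intro norm_le_1_if_sum_squares_eq_1[OF cs k]) (simp_all add: ss)
  then show ?thesis
    using norm_square_selfadjoint[OF cs] by (simp add: ss power_le_one)
qed

section \<open>Positive elements of a unital C*-algebra\<close>

definition pos :: "'a::cstar_algebra \<Rightarrow> bool" where
  "pos a \<longleftrightarrow> (\<exists>k. cstar k = k \<and> a = k * k)"

lemma pos_square: "cstar k = k \<Longrightarrow> pos (k * k)"
  by (auto simp: pos_def)

lemma pos_selfadjoint: "pos a \<Longrightarrow> cstar a = a"
  by (auto simp: pos_def cstar_mult)

lemma pos_scaleR:
  assumes "pos a" "0 \<le> r"
  shows "pos (r *\<^sub>R a)"
proof -
  obtain k where "cstar k = k" "a = k * k" using assms by (auto simp: pos_def)
  then have "cstar (sqrt r *\<^sub>R k) = sqrt r *\<^sub>R k" "r *\<^sub>R a = (sqrt r *\<^sub>R k) * (sqrt r *\<^sub>R k)"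
    using assms by (simp_all add: cstar_scaleR)
  then show ?thesis by (auto simp: pos_def)
qed

lemma pos_norm_le:
  fixes a :: "'a::{cstar_algebra, real_normed_algebra_1}"
  assumes "pos a" "norm a \<le> t"
  shows "norm (t *\<^sub>R 1 - a) \<le> t"
proof (cases "t = 0")
  case False
  then have t: "t > 0" using assms(2) norm_ge_zero[of a] by linarith
  have "pos (inverse t *\<^sub>R a)" using t assms(1) by (intro pos_scaleR) auto
  then obtain k where k: "cstar k = k" "inverse t *\<^sub>R a = k * k" by (auto simp: pos_def)
  have "(norm k)\<^sup>2 = inverse t * norm a"
    using t by (simp flip: norm_square_selfadjoint[OF k(1)] k(2))
  also have "\<dots> \<le> 1" using t assms(2) by (simp add: field_simps)
  finally have "norm k \<le> 1" by (simp add: power_le_one_iff)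
  from norm_one_minus_square_le[OF k(1) this]
  have "norm (1 - inverse t *\<^sub>R a) \<le> 1" by (simp add: k)
  moreover have "t *\<^sub>R 1 - a = t *\<^sub>R (1 - inverse t *\<^sub>R a)"
    using t by (simp add: scaleR_diff_right)
  ultimately show ?thesis
    using t by simp
qed (use assms in auto)

text \<open>After division by \<open>t\<close>, the element \<open>w = 1 - a / t\<close> lies in the
  closed unit ball, where the series for the root of \<open>1 - w\<close> converges.\<close>

lemma sqrt_exists:
  fixes a :: "'a::{cstar_algebra, real_normed_algebra_1}"
  assumes a: "cstar a = a" and le: "norm (t *\<^sub>R 1 - a) \<le> t"
  obtains g where "cstar g = g" "g * g = a" "\<And>z. z * a = a * z \<Longrightarrow> z * g = g * z"
proof (cases "t = 0")
  case True
  then have "a = 0" using le by simp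
  then show ?thesis by (intro that[of 0]) auto
next
  case False
  then have t: "t > 0" using le norm_ge_zero[of "t *\<^sub>R 1 - a"] by linarith
  define w where "w = 1 - inverse t *\<^sub>R a"
  define g where "g = sqrt t *\<^sub>R (1 - sqrt_series w)"
  have "w = inverse t *\<^sub>R (t *\<^sub>R 1 - a)"
    using t by (simp add: w_def scaleR_diff_right)
  then have "norm w = norm (t *\<^sub>R 1 - a) / t" using t by (simp add: divide_inverse)
  then have w: "norm w \<le> 1" using t le by simp
  have "cstar w = w" by (simp add: w_def cstar_diff cstar_scaleR a)
  then have "cstar g = g"
    by (simp add: g_def cstar_scaleR cstar_diff cstar_sqrt_series[OF w])
  moreover have "g * g = a"
    using t by (simp add: g_def one_minus_sqrt_series_square[OF w]) (simp add: w_def)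
  moreover have "z * g = g * z" if "z * a = a * z" for z
    using sqrt_series_intertwine[OF w w, of z] that by (simp add: g_def w_def algebra_simps)
  ultimately show ?thesis by (rule that)
qed

text \<open>With \<open>pos_norm_le\<close>, this characterises positivity of a selfadjoint element
  by a norm inequality, without mentioning roots.\<close>

lemma posI:
  fixes a :: "'a::{cstar_algebra, real_normed_algebra_1}"
  assumes "cstar a = a" "norm (t *\<^sub>R 1 - a) \<le> t"
  shows "pos a"
  using sqrt_exists[OF assms] pos_square by metis

text \<open>The gain over the definition of \<open>pos\<close> is a root that commutes with
  everything commuting with \<open>a\<close>.\<close>

lemma pos_sqrt:
  fixes a :: "'a::{cstar_algebra, real_normed_algebra_1}"
  assumes "pos a"
  obtains g where "cstar g = g" "g * g = a" "\<And>z. z * a = a * z \<Longrightarrow> z * g = g * z"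
  using sqrt_exists[OF pos_selfadjoint[OF assms] pos_norm_le[OF assms order_refl]] by blast

text \<open>The norm criterion is additive in \<open>a\<close> and \<open>t\<close> by the triangle
  inequality.\<close>

lemma pos_add:
  fixes a b :: "'a::{cstar_algebra, real_normed_algebra_1}"
  assumes "pos a" "pos b"
  shows "pos (a + b)"
proof (rule posI[where t = "norm a + norm b"])
  show "cstar (a + b) = a + b" using assms by (simp add: cstar_add pos_selfadjoint)
  have "norm ((norm a *\<^sub>R 1 - a) + (norm b *\<^sub>R 1 - b)) \<le> norm a + norm b"
    by (intro norm_triangle_mono pos_norm_le assms order_refl)
  then show "norm ((norm a + norm b) *\<^sub>R 1 - (a + b)) \<le> norm a + norm b"
    by (simp add: algebra_simps)
qed

text \<open>Normalise to \<open>norm x = 1\<close>. Then \<open>1 - x\<close> and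
  \<open>1 + x\<close> have norm at most 1, and so does 1 minus the square of either. The difference
  of these last two is \<open>4 x\<close>, so \<open>4 \<le> 2\<close>.\<close>

lemma pos_antisym:
  fixes a :: "'a::{cstar_algebra, real_normed_algebra_1}"
  assumes "pos a" "pos (- a)"
  shows "a = 0"
proof (rule ccontr)
  assume "a \<noteq> 0"
  define x where "x = inverse (norm a) *\<^sub>R a"
  have x: "norm x = 1" using \<open>a \<noteq> 0\<close> by (simp add: x_def)
  have p: "pos x" "pos (- x)"
    using pos_scaleR[OF assms(1), of "inverse (norm a)"] pos_scaleR[OF assms(2), of "inverse (norm a)"]
    by (simp_all add: x_def)
  have "norm (1 - x) \<le> 1" "norm (1 + x) \<le> 1"
    using pos_norm_le[OF p(1), of 1] pos_norm_le[OF p(2), of 1] x by simp_all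
  then have "norm (1 - (1 - x) * (1 - x)) \<le> 1" "norm (1 - (1 + x) * (1 + x)) \<le> 1"
    using pos_selfadjoint[OF p(1)] by (intro norm_one_minus_square_le; simp add: cstar_diff cstar_add)+
  then have "norm ((1 - (1 - x) * (1 - x)) - (1 - (1 + x) * (1 + x))) \<le> 1 + 1"
    by (rule norm_triangle_le_diff[OF add_mono])
  moreover have "(1 - (1 - x) * (1 - x)) - (1 - (1 + x) * (1 + x)) = 4 *\<^sub>R x"
    using scaleR_left_distrib[of 2 2 x] by (simp add: algebra_simps scaleR_2)
  ultimately show False using x by simp
qed

text \<open>A root \<open>g\<close> of \<open>a\<close> that commutes with \<open>d\<close> makes
  this the square of the selfadjoint element \<open>g * d\<close>.\<close>

lemma pos_sandwich:
  fixes a d :: "'a::{cstar_algebra, real_normed_algebra_1}"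
  assumes a: "pos a" and d: "cstar d = d" "d * a = a * d"
  shows "pos (d * a * d)"
proof -
  obtain g where g: "cstar g = g" "g * g = a" "d * g = g * d"
    using pos_sqrt[OF a] d(2) by metis
  have "d * a * d = (g * d) * (g * d)"
    by (metis g(2,3) mult.assoc)
  moreover have "cstar (g * d) = g * d" by (simp add: cstar_mult g d(1))
  ultimately show ?thesis by (metis pos_square)
qed

text \<open>The fourth power vanishes too; two applications of the C*-identity then give
  \<open>d = 0\<close>.\<close>

lemma selfadjoint_cube_eq_0D:
  fixes d :: "'a::cstar_algebra"
  assumes d: "cstar d = d" and "d * d * d = 0"
  shows "d = 0"
proof -
  have "cstar (d * d) * (d * d) = 0"
    using assms by (simp add: cstar_mult flip: mult.assoc)
  then have "cstar d * d = 0"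
    by (simp only: cstar_mult_self_eq_0 d)
  then show ?thesis by (simp only: cstar_mult_self_eq_0)
qed

text \<open>For the difference \<open>d\<close> of two roots, \<open>d m d + d n d = 0\<close> with both summands positive.\<close>

lemma pos_sqrt_unique:
  fixes m n :: "'a::{cstar_algebra, real_normed_algebra_1}"
  assumes m: "pos m" and n: "pos n" and com: "m * n = n * m" and eq: "m * m = n * n"
  shows "m = n"
proof -
  define d where "d = m - n"
  have cd: "cstar d = d" by (simp add: d_def cstar_diff pos_selfadjoint m n)
  have dm: "d * m = m * d" and dn: "d * n = n * d"
    by (simp_all add: d_def algebra_simps com)
  have "d * (m + n) = 0"
    by (simp add: d_def algebra_simps com eq)
  then have "d * m * d = - (d * n * d)"
    by (metis add_eq_0_iff2 distrib_left distrib_right mult_zero_left)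
  then have "d * m * d = 0" "d * n * d = 0"
    using pos_antisym pos_sandwich[OF m cd dm] pos_sandwich[OF n cd dn]
    by (metis minus_minus, metis)
  moreover have "d * d * d = d * m * d - d * n * d"
    by (subst (2) d_def) (simp add: right_diff_distrib left_diff_distrib)
  ultimately have "d = 0" using selfadjoint_cube_eq_0D[OF cd] by simp
  then show ?thesis by (simp add: d_def)
qed

text \<open>The absolute value, that is the root of \<open>k * k\<close>, for selfadjoint
  \<open>k\<close> of norm at most 1. Being an explicit series, it inherits intertwining
  relations.\<close>

definition abs_sa :: "'a::{cstar_algebra, real_normed_algebra_1} \<Rightarrow> 'a" where
  "abs_sa k = 1 - sqrt_series (1 - k * k)"

context
  fixes k :: "'a::{cstar_algebra, real_normed_algebra_1}"
  assumes k: "cstar k = k" "norm k \<le> 1"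
begin

lemma pos_abs_sa: "pos (abs_sa k)"
proof (rule posI[where t = 1])
  note n = norm_one_minus_square_le[OF k]
  show "cstar (abs_sa k) = abs_sa k"
    by (simp add: abs_sa_def cstar_diff cstar_sqrt_series[OF n] cstar_mult k)
  show "norm (1 *\<^sub>R 1 - abs_sa k) \<le> 1"
    by (simp add: abs_sa_def norm_sqrt_series_le[OF n])
qed

lemma abs_sa_square: "abs_sa k * abs_sa k = k * k"
  unfolding abs_sa_def by (simp add: one_minus_sqrt_series_square norm_one_minus_square_le k)

lemma abs_sa_intertwine:
  assumes k': "cstar k' = k'" "norm k' \<le> 1" and "z * (k * k) = (k' * k') * z"
  shows "z * abs_sa k = abs_sa k' * z"
  using sqrt_series_intertwine[OF norm_one_minus_square_le[OF k] norm_one_minus_square_le[OF k'], of z]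
    assms(3)
  by (simp add: abs_sa_def right_diff_distrib left_diff_distrib)

lemma abs_sa_commute: "k * abs_sa k = abs_sa k * k"
  by (rule abs_sa_intertwine[OF k]) (simp add: mult.assoc)

end

text \<open>Both sides are positive roots of \<open>a * a\<close>, and they commute.\<close>

lemma abs_sa_pos:
  fixes a :: "'a::{cstar_algebra, real_normed_algebra_1}"
  assumes a: "pos a" "norm a \<le> 1"
  shows "abs_sa a = a"
proof (rule pos_sqrt_unique)
  note sa = pos_selfadjoint[OF a(1)] a(2)
  show "pos (abs_sa a)" by (rule pos_abs_sa[OF sa])
  show "abs_sa a * a = a * abs_sa a" by (rule abs_sa_commute[OF sa, symmetric])
  show "abs_sa a * abs_sa a = a * a" by (rule abs_sa_square[OF sa])
qed (rule a)

text \<open>With \<open>p = - c\<^sup>* c\<close> and \<open>n = c c\<^sup>*\<close>, both positive, \<open>n c = - c p\<close> gives \<open>n\<^sup>2 c = c p\<^sup>2\<close>; taking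
  positive square roots turns this into \<open>n c = c p\<close>.\<close>

lemma pos_minus_cstar_mult_selfD:
  fixes c :: "'a::{cstar_algebra, real_normed_algebra_1}"
  assumes neg: "pos (- (cstar c * c))"
  shows "c = 0"
proof -
  have small: "c = 0" if neg: "pos (- (cstar c * c))" and le: "norm c \<le> 1" for c :: 'a
  proof -
    define p where "p = - (cstar c * c)"
    define n where "n = c * cstar c"
    define x where "x = c + cstar c"
    define y where "y = \<i> *\<^sub>C (c - cstar c)"
    have p: "pos p" by (simp add: p_def neg)
    have "cstar x = x" by (simp add: x_def cstar_add cstar_cstar)
    moreover have "cstar y = y"
      by (simp add: y_def cstar_scaleC cstar_diff cstar_cstar scaleC_diff_right)
    moreover have "n = (1/2) *\<^sub>R (x * x + y * y) + p"
    \<comment> \<open>\<open>x\<close> is twice the real part of \<open>c\<close> and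
      \<open>y\<close> minus twice its imaginary part, so the squares add up to
      \<open>2 * (cstar c * c + c * cstar c)\<close>.\<close>
    proof -
      have "y * y = - ((c - cstar c) * (c - cstar c))"
        by (simp add: y_def scaleC_mult_left scaleC_mult_right scaleC_scaleC scaleC_one)
      then have "x * x + y * y = 2 *\<^sub>R (n - p)"
        by (simp add: x_def n_def p_def algebra_simps scaleR_2)
      then show ?thesis by simp
    qed
    ultimately have n: "pos n"
      using p by (auto intro!: pos_add pos_scaleR pos_square)
    have np: "norm p \<le> 1" "norm n \<le> 1"
      using le cstar_identity[of c] cstar_identity[of "cstar c"]
      by (simp_all add: p_def n_def cstar_cstar power_le_one)
    have nc: "n * c = - (c * p)" by (simp add: n_def p_def mult.assoc)
    then have "c * (p * p) = (n * n) * c"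
      by (metis minus_minus minus_mult_left minus_mult_right mult.assoc)
    then have "c * abs_sa p = abs_sa n * c"
      by (rule abs_sa_intertwine[OF pos_selfadjoint[OF p] np(1) pos_selfadjoint[OF n] np(2)])
    then have "c * p = n * c"
      by (simp add: abs_sa_pos p n np)
    with nc have "2 *\<^sub>R (c * p) = 0" by (simp add: scaleR_2 eq_neg_iff_add_eq_0)
    moreover have "p * p = - (cstar c * (c * p))" by (simp add: p_def mult.assoc)
    ultimately have "p * p = 0" by simp
    then have "cstar p * p = 0" by (simp add: pos_selfadjoint[OF p])
    then show "c = 0" by (simp only: cstar_mult_self_eq_0) (simp add: p_def cstar_mult_self_eq_0)
  qed
  define r where "r = inverse (norm c)"
  have "r *\<^sub>R c = 0"
  proof (rule small)
    have "- (cstar (r *\<^sub>R c) * (r *\<^sub>R c)) = (r * r) *\<^sub>R (- (cstar c * c))"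
      by (simp add: cstar_scaleR)
    then show "pos (- (cstar (r *\<^sub>R c) * (r *\<^sub>R c)))"
      using neg by (simp only:) (rule pos_scaleR, auto)
    show "norm (r *\<^sub>R c) \<le> 1" by (cases "c = 0") (simp_all add: r_def)
  qed
  then show ?thesis by (auto simp: r_def)
qed

text \<open>Twice the negative part \<open>v\<close> of \<open>k = b\<^sup>* b\<close> satisfies \<open>(b v)\<^sup>* (b v) = v k v = - v \<bar>k\<bar> v\<close>.\<close>

theorem pos_cstar_mult_self:
  fixes b :: "'a::{cstar_algebra, real_normed_algebra_1}"
  shows "pos (cstar b * b)"
proof -
  have small: "pos (cstar b * b)" if le: "norm b \<le> 1" for b :: 'a
  proof -
    define k where "k = cstar b * b"
    define m where "m = abs_sa k"
    define v where "v = m - k"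
    have k: "cstar k = k" "norm k \<le> 1"
      using le by (simp_all add: k_def cstar_mult cstar_cstar cstar_identity power_le_one)
    have m: "pos m" and mk: "k * m = m * k" and mm: "m * m = k * k"
      unfolding m_def by (rule pos_abs_sa abs_sa_commute abs_sa_square k)+
    have v: "cstar v = v" by (simp add: v_def cstar_diff k pos_selfadjoint[OF m])
    have vm: "v * m = m * v" by (simp add: v_def algebra_simps mk)
    \<comment> \<open>Since \<open>m\<close> and \<open>k\<close> commute, this product is
      \<open>m * m - k * k\<close>; hence \<open>k * v = - (m * v)\<close>.\<close>
    have "(m + k) * v = 0" by (simp add: v_def algebra_simps mk mm)
    then have vkv: "v * k * v = - (v * m * v)"
      by (metis add_eq_0_iff distrib_right mult.assoc mult_minus_right)
    have "cstar (b * v) * (b * v) = v * k * v"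
      by (simp add: cstar_mult v k_def mult.assoc)
    then have "pos (- (cstar (b * v) * (b * v)))"
      using pos_sandwich[OF m v vm] by (simp add: vkv)
    then have "b * v = 0" by (rule pos_minus_cstar_mult_selfD)
    then have "v * k * v = 0" by (simp add: k_def mult.assoc)
    moreover have "v * v * v = v * m * v - v * k * v"
      by (subst (2) v_def) (simp add: right_diff_distrib left_diff_distrib)
    ultimately have "v = 0" using selfadjoint_cube_eq_0D[OF v] vkv by simp
    then have "k = m" by (simp add: v_def)
    with m show ?thesis by (simp add: k_def)
  qed
  show ?thesis
  proof (cases "b = 0")
    case False
    define r where "r = norm b"
    have "pos ((r * r) *\<^sub>R (cstar (inverse r *\<^sub>R b) * (inverse r *\<^sub>R b)))"
      using False by (intro pos_scaleR small) (simp_all add: r_def)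
    moreover have "(r * r) *\<^sub>R (cstar (inverse r *\<^sub>R b) * (inverse r *\<^sub>R b)) = cstar b * b"
      using False by (simp add: r_def cstar_scaleR field_simps)
    ultimately show ?thesis by simp
  qed (use pos_square[of "0 :: 'a"] in simp)
qed

text \<open>If \<open>a = s\<^sup>2\<close> and \<open>1 - a = r\<^sup>2\<close> then \<open>1 - 2 a + 2 i s r = (r + i s)\<^sup>2\<close> is unitary.\<close>

lemma norm_one_minus_twice_pos_le:
  fixes a :: "'a::{cstar_algebra, real_normed_algebra_1}"
  assumes "pos a" and a: "norm a \<le> 1"
  shows "norm (1 - 2 *\<^sub>R a) \<le> 1"
proof -
  obtain s where s: "cstar s = s" "a = s * s" using \<open>pos a\<close> by (auto simp: pos_def)
  define r where "r = 1 - sqrt_series a"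
  have r: "cstar r = r"
    by (simp add: r_def cstar_diff cstar_sqrt_series[OF a] pos_selfadjoint[OF \<open>pos a\<close>])
  have rr: "r * r = 1 - s * s"
    by (simp add: r_def one_minus_sqrt_series_square[OF a] flip: s(2))
  have sr: "s * r = r * s"
    using sqrt_series_intertwine[OF a a, of s]
    by (simp add: r_def s(2) algebra_simps)
  have srsr: "(s * r) * (s * r) = a - a * a"
  proof -
    have "(s * r) * (s * r) = s * (r * r) * s" by (metis sr mult.assoc)
    also have "\<dots> = a - a * a" by (simp add: rr s(2) algebra_simps)
    finally show ?thesis .
  qed
  have as: "a * (s * r) = (s * r) * a"
    by (metis s(2) sr mult.assoc)
  show ?thesis
  proof (rule norm_le_1_if_sum_squares_eq_1)
    show "cstar (1 - 2 *\<^sub>R a) = 1 - 2 *\<^sub>R a"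
      by (simp add: cstar_diff cstar_scaleR pos_selfadjoint[OF \<open>pos a\<close>])
    show "cstar (2 *\<^sub>R (s * r)) = 2 *\<^sub>R (s * r)"
      by (simp add: cstar_scaleR cstar_mult s(1) r sr)
    show "(1 - 2 *\<^sub>R a) * 2 *\<^sub>R (s * r) = 2 *\<^sub>R (s * r) * (1 - 2 *\<^sub>R a)"
      by (simp add: left_diff_distrib right_diff_distrib scaleR_diff_right as)
    have "(1 - 2 *\<^sub>R a) * (1 - 2 *\<^sub>R a) + 2 *\<^sub>R (s * r) * 2 *\<^sub>R (s * r)
        = 1 - 4 *\<^sub>R a + 4 *\<^sub>R (a * a) + 4 *\<^sub>R ((s * r) * (s * r))"
      using scaleR_left_distrib[of 2 2 a]
      by (simp add: left_diff_distrib right_diff_distrib scaleR_diff_right)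
    then show "(1 - 2 *\<^sub>R a) * (1 - 2 *\<^sub>R a) + 2 *\<^sub>R (s * r) * 2 *\<^sub>R (s * r) = 1"
      by (simp add: srsr scaleR_diff_right)
  qed
qed

text \<open>In the unitization, \<open>2 (a - p)\<close> is the difference of \<open>1 - 2 p\<close>
  and \<open>1 - 2 a\<close>, each of norm at most 1.\<close>

lemma norm_diff_positive_le:
  fixes a p :: "'a::cstar_algebra"
  assumes "positive a" "positive p" "norm a \<le> 1" "norm p \<le> 1"
  shows "norm (a - p) \<le> 1"
proof -
  have bound: "norm (1 - 2 *\<^sub>R Unitization q 0) \<le> 1" if "positive q" "norm q \<le> 1" for q :: 'a
  proof (rule norm_one_minus_twice_pos_le)
    obtain b where "q = cstar b * b" using \<open>positive q\<close> by (auto simp: positive_def)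
    then have "Unitization q 0 = cstar (Unitization b 0) * Unitization b 0"
      by (simp add: cstar_unitization_def times_unitization_def)
    then show "pos (Unitization q 0)" by (simp add: pos_cstar_mult_self)
    show "norm (Unitization q 0) \<le> 1" using that by (simp add: norm_Unitization_0)
  qed
  have "2 *\<^sub>R Unitization (a - p) 0 = (1 - 2 *\<^sub>R Unitization p 0) - (1 - 2 *\<^sub>R Unitization a 0)"
    by (simp add: scaleR_unitization_def unitization_ops algebra_simps)
  then have "norm (2 *\<^sub>R Unitization (a - p) 0) \<le> 1 + 1"
    using bound[OF assms(1,3)] bound[OF assms(2,4)] by (metis add_mono norm_triangle_le_diff)
  then show ?thesis by (simp add: norm_Unitization_0)
qed

section \<open>The Hahn-Banach theorem\<close>

definition sublinear :: "('v::real_vector \<Rightarrow> real) \<Rightarrow> bool" where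
  "sublinear q \<longleftrightarrow> (\<forall>x y. q (x + y) \<le> q x + q y) \<and> (\<forall>r\<ge>0. \<forall>x. q (r *\<^sub>R x) = r * q x)"

lemma sublinear_add: "sublinear q \<Longrightarrow> q (x + y) \<le> q x + q y"
  and sublinear_scale: "sublinear q \<Longrightarrow> 0 \<le> r \<Longrightarrow> q (r *\<^sub>R x) = r * q x"
  by (auto simp: sublinear_def)

lemma sublinear_zero: "sublinear q \<Longrightarrow> q 0 = 0"
  using sublinear_scale[of q 0 0] by simp

lemma sublinear_minus_le: "sublinear q \<Longrightarrow> - q (- x) \<le> q x"
  using sublinear_add[of q x "- x"] sublinear_zero[of q] by simp

lemma sublinearI:
  assumes add: "\<And>x y. q (x + y) \<le> q x + q y"
    and scale: "\<And>r x. 0 < r \<Longrightarrow> q (r *\<^sub>R x) \<le> r * q x"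
    and zero: "q 0 = 0"
  shows "sublinear q"
  unfolding sublinear_def
proof (intro conjI allI impI add)
  fix r :: real and x assume "0 \<le> r"
  show "q (r *\<^sub>R x) = r * q x"
  proof (cases "r = 0")
    case False
    with \<open>0 \<le> r\<close> have r: "0 < r" by simp
    have "r * q x = r * q (inverse r *\<^sub>R r *\<^sub>R x)" using r by simp
    also have "\<dots> \<le> r * (inverse r * q (r *\<^sub>R x))"
      using r by (intro mult_left_mono scale) auto
    also have "\<dots> = q (r *\<^sub>R x)" using r by simp
    finally show ?thesis using scale[OF r, of x] by simp
  qed (simp add: zero)
qed

text \<open>Pushing \<open>q\<close> down as far as possible along a convex cone \<open>C\<close> of pairs \<open>(u, b)\<close> on which
  \<open>b \<le> q u\<close>, so that linear functionals below the result satisfy \<open>b \<le> f u\<close> on \<open>C\<close>.\<close>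

definition cone_inf :: "('v::real_vector \<times> real) set \<Rightarrow> ('v \<Rightarrow> real) \<Rightarrow> 'v \<Rightarrow> real" where
  "cone_inf C q z = (INF (u, b)\<in>C. q (z + u) - b)"

context
  fixes C :: "('v::real_vector \<times> real) set" and q :: "'v \<Rightarrow> real"
  assumes q: "sublinear q"
    and zero: "(0, 0) \<in> C"
    and add: "\<And>u b v c. (u, b) \<in> C \<Longrightarrow> (v, c) \<in> C \<Longrightarrow> (u + v, b + c) \<in> C"
    and scale: "\<And>u b r. (u, b) \<in> C \<Longrightarrow> 0 < r \<Longrightarrow> (r *\<^sub>R u, r * b) \<in> C"
    and below: "\<And>u b. (u, b) \<in> C \<Longrightarrow> b \<le> q u"
begin

text \<open>The infimum is over a set bounded below by \<open>- q (- z)\<close>, because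
  \<open>c \<le> q v \<le> q (z + v) + q (- z)\<close> for \<open>(v, c)\<close> in the
  cone.\<close>

lemma cone_inf_le:
  assumes "(u, b) \<in> C"
  shows "cone_inf C q z \<le> q (z + u) - b"
proof -
  have "- q (- z) \<le> q (z + v) - c" if "(v, c) \<in> C" for v c
    using sublinear_add[OF q, of "z + v" "- z"] below[OF that] by simp
  then have "bdd_below ((\<lambda>(u, b). q (z + u) - b) ` C)"
    by (intro bdd_belowI[of _ "- q (- z)"]) auto
  from cINF_lower[OF this assms] show ?thesis by (simp add: cone_inf_def)
qed

lemma cone_inf_greatest:
  assumes "\<And>u b. (u, b) \<in> C \<Longrightarrow> l \<le> q (z + u) - b"
  shows "l \<le> cone_inf C q z"
  unfolding cone_inf_def using assms zero by (intro cINF_greatest) auto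

lemma cone_inf_le_self: "cone_inf C q z \<le> q z"
  using cone_inf_le[OF zero, of z] by simp

lemma cone_inf_minus_le: "(u, b) \<in> C \<Longrightarrow> cone_inf C q (- u) \<le> - b"
  using cone_inf_le[of u b "- u"] sublinear_zero[OF q] by simp

lemma sublinear_cone_inf: "sublinear (cone_inf C q)"
proof (rule sublinearI)
  show "cone_inf C q (x + y) \<le> cone_inf C q x + cone_inf C q y" for x y
  proof -
    have "cone_inf C q (x + y) - cone_inf C q x \<le> cone_inf C q y"
    proof (rule cone_inf_greatest)
      fix v c assume v: "(v, c) \<in> C"
      have "cone_inf C q (x + y) - (q (y + v) - c) \<le> cone_inf C q x"
      proof (rule cone_inf_greatest)
        fix u b assume u: "(u, b) \<in> C"
        have "cone_inf C q (x + y) \<le> q (x + y + (u + v)) - (b + c)"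
          by (rule cone_inf_le[OF add[OF u v]])
        also have "x + y + (u + v) = (x + u) + (y + v)" by simp
        finally show "cone_inf C q (x + y) - (q (y + v) - c) \<le> q (x + u) - b"
          using sublinear_add[OF q, of "x + u" "y + v"] by linarith
      qed
      then show "cone_inf C q (x + y) - cone_inf C q x \<le> q (y + v) - c" by linarith
    qed
    then show ?thesis by linarith
  qed
  show "cone_inf C q (r *\<^sub>R x) \<le> r * cone_inf C q x" if r: "0 < r" for r x
  proof -
    have "inverse r * cone_inf C q (r *\<^sub>R x) \<le> cone_inf C q x"
    proof (rule cone_inf_greatest)
      fix u b assume u: "(u, b) \<in> C"
      have "cone_inf C q (r *\<^sub>R x) \<le> q (r *\<^sub>R (x + u)) - r * b"
        using cone_inf_le[OF scale[OF u r], of "r *\<^sub>R x"] by (simp add: scaleR_right_distrib)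
      also have "\<dots> = r * (q (x + u) - b)"
        using r by (simp add: sublinear_scale[OF q] right_diff_distrib)
      finally show "inverse r * cone_inf C q (r *\<^sub>R x) \<le> q (x + u) - b"
        using r by (simp add: field_simps)
    qed
    then show ?thesis using r by (simp add: field_simps)
  qed
  show "cone_inf C q 0 = 0"
    using cone_inf_le_self[of 0] sublinear_zero[OF q] below
    by (intro antisym cone_inf_greatest) auto
qed

end

text \<open>Pushing \<open>q\<close> down along the ray through \<open>(x, q x)\<close> cannot
  change it, so \<open>q (- x) \<le> - q x\<close>. An odd sublinear functional is linear.\<close>

lemma minimal_sublinear_linear:
  assumes q: "sublinear q" and min: "\<And>q'. sublinear q' \<Longrightarrow> q' \<le> q \<Longrightarrow> q' = q"
  shows "linear q"
proof -
  have minus: "q (- x) = - q x" for x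
  proof -
    define C where "C = {(r *\<^sub>R x, r * q x) | r. 0 \<le> r}"
    have C: "(0, 0) \<in> C" "(u, b) \<in> C \<Longrightarrow> (v, c) \<in> C \<Longrightarrow> (u + v, b + c) \<in> C"
      "(u, b) \<in> C \<Longrightarrow> 0 < s \<Longrightarrow> (s *\<^sub>R u, s * b) \<in> C" "(u, b) \<in> C \<Longrightarrow> b \<le> q u" for u b v c s
    proof -
      show "(0, 0) \<in> C" unfolding C_def by (auto intro!: exI[of _ 0])
      show "(u + v, b + c) \<in> C" if "(u, b) \<in> C" "(v, c) \<in> C"
        using that unfolding C_def
        by (auto simp flip: scaleR_left_distrib distrib_right intro: add_nonneg_nonneg)
      show "(s *\<^sub>R u, s * b) \<in> C" if "(u, b) \<in> C" "0 < s"
      proof -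
        from that(1) obtain r where "0 \<le> r" "u = r *\<^sub>R x" "b = r * q x" unfolding C_def by blast
        with that(2) show ?thesis unfolding C_def by (auto intro!: exI[of _ "s * r"])
      qed
      show "b \<le> q u" if "(u, b) \<in> C"
        using that unfolding C_def by (auto simp: sublinear_scale[OF q])
    qed
    have "cone_inf C q = q"
      by (intro min sublinear_cone_inf q C le_funI cone_inf_le_self)
    moreover have "(x, q x) \<in> C" unfolding C_def by (auto intro!: exI[of _ 1])
    then have "cone_inf C q (- x) \<le> - q x"
      by (intro cone_inf_minus_le q C)
    ultimately show ?thesis
      using sublinear_minus_le[OF q, of "- x"] by simp
  qed
  show ?thesis
  proof (rule linearI)
    show "q (x + y) = q x + q y" for x y
      using sublinear_add[OF q, of x y] sublinear_add[OF q, of "- x" "- y"] minus[of "x + y"]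
      by (simp add: minus)
    show "q (r *\<^sub>R x) = r *\<^sub>R q x" for r x
    proof (cases "0 \<le> r")
      case False
      then have "q ((- r) *\<^sub>R x) = (- r) * q x" by (intro sublinear_scale[OF q]) simp
      then show ?thesis by (simp add: minus)
    qed (simp add: sublinear_scale[OF q])
  qed
qed

text \<open>Zorn's lemma for the reversed pointwise order yields a minimal sublinear functional
  below \<open>p\<close>; a chain is bounded by its pointwise infimum.\<close>

theorem hahn_banach_sublinear:
  assumes p: "sublinear p"
  obtains f where "linear f" "\<And>x. f x \<le> p x"
proof -
  define S where "S = {q. sublinear q \<and> q \<le> p}"
  have "\<exists>m\<in>S. \<forall>q\<in>S. m \<ge> q \<longrightarrow> q = m"
  proof (rule predicate_Zorn)
    show "partial_order_on S (relation_of (\<ge>) S)"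
      by (rule partial_order_on_relation_ofI) auto
    fix Q assume Q: "Q \<in> Chains (relation_of (\<ge>) S)"
    have QS: "q \<in> S" if "q \<in> Q" for q
      using that Q by (auto simp: Chains_def relation_of_def)
    have chain: "q \<le> q' \<or> q' \<le> q" if "q \<in> Q" "q' \<in> Q" for q q'
      using that Q by (auto simp: Chains_def relation_of_def)
    show "\<exists>m\<in>S. \<forall>q\<in>Q. q \<ge> m"
    proof (cases "Q = {}")
      case True
      with p show ?thesis by (auto simp: S_def)
    next
      case False
      define m where "m z = (INF q\<in>Q. q z)" for z
      have lower: "m z \<le> q z" if "q \<in> Q" for q z
      proof -
        have "- p (- z) \<le> q' z" if "q' \<in> Q" for q'
          using QS[OF that] sublinear_minus_le[of q' z] by (auto simp: S_def le_fun_def intro: order_trans[rotated])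
        then show ?thesis
          unfolding m_def using that by (intro cINF_lower bdd_belowI[of _ "- p (- z)"]) auto
      qed
      have greatest: "l \<le> m z" if "\<And>q. q \<in> Q \<Longrightarrow> l \<le> q z" for l z
        unfolding m_def using that False by (intro cINF_greatest) auto
      have sub: "sublinear q" if "q \<in> Q" for q using QS[OF that] by (simp add: S_def)
      have "sublinear m"
      proof (rule sublinearI)
        show "m (x + y) \<le> m x + m y" for x y
        proof -
          have le: "m (x + y) \<le> q x + q' y" if "q \<in> Q" "q' \<in> Q" for q q'
          proof -
            \<comment> \<open>The smaller of the two functionals serves for both summands.\<close>
            from chain[OF that] that obtain q'' where "q'' \<in> Q" "q'' \<le> q" "q'' \<le> q'"
              by (metis order_refl)
            then show ?thesis
              using lower[of q'' "x + y"] sublinear_add[OF sub, of q'' x y]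
                le_funD[OF \<open>q'' \<le> q\<close>, of x] le_funD[OF \<open>q'' \<le> q'\<close>, of y] by linarith
          qed
          have "m (x + y) - q x \<le> m y" if "q \<in> Q" for q
            by (intro greatest) (use le[OF that] in \<open>simp add: diff_le_eq add.commute\<close>)
          then have "m (x + y) - m y \<le> m x"
            by (intro greatest) (simp add: diff_le_eq add.commute)
          then show ?thesis by simp
        qed
        show "m (r *\<^sub>R x) \<le> r * m x" if r: "0 < r" for r x
        proof -
          have "inverse r * m (r *\<^sub>R x) \<le> m x"
          proof (rule greatest)
            fix q assume "q \<in> Q"
            then show "inverse r * m (r *\<^sub>R x) \<le> q x"
              using lower[of q "r *\<^sub>R x"] r by (simp add: sublinear_scale[OF sub] field_simps)
          qed
          then show ?thesis using r by (simp add: field_simps)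
        qed
        obtain q where "q \<in> Q" using False by blast
        then show "m 0 = 0"
          using lower[of q 0] by (intro antisym greatest) (auto simp: sublinear_zero[OF sub])
      qed
      moreover obtain q where "q \<in> Q" using False by blast
      then have "m \<le> p"
        using lower[of q] QS[of q] by (auto simp: S_def le_fun_def intro: order_trans)
      ultimately show ?thesis
        using lower by (auto simp: S_def le_fun_def)
    qed
  qed
  then obtain m where m: "m \<in> S" and min: "\<And>q. q \<in> S \<Longrightarrow> q \<le> m \<Longrightarrow> q = m" by blast
  have "linear m"
    using m by (intro minimal_sublinear_linear min) (auto simp: S_def)
  moreover have "m x \<le> p x" for x using m by (auto simp: S_def le_fun_def)
  ultimately show ?thesis by (rule that)
qed

text \<open>The norm is pushed down along the cone spanned by \<open>(a, \<parallel>a\<parallel>)\<close> and \<open>(\<plusminus> h, 0)\<close>.\<close>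

lemma norming_functional_vanishing_at:
  fixes a h :: "'v::real_normed_vector"
  assumes orth: "\<And>r. norm a \<le> norm (a + r *\<^sub>R h)"
  obtains f where "linear f" "\<And>z. f z \<le> norm z" "f a = norm a" "f h = 0"
proof -
  define C where "C = {(t *\<^sub>R a + s *\<^sub>R h, t * norm a) | t s. 0 \<le> t}"
  have norm: "sublinear (norm :: 'v \<Rightarrow> real)" by (auto simp: sublinear_def norm_triangle_ineq)
  have CI: "0 \<le> t \<Longrightarrow> (t *\<^sub>R a + s *\<^sub>R h, t * norm a) \<in> C" for t s unfolding C_def by blast
  have zero: "(0, 0) \<in> C" using CI[of 0 0] by simp
  have add: "(u + v, b + c) \<in> C" if "(u, b) \<in> C" "(v, c) \<in> C" for u v b c
  proof -
    from that obtain t s t' s' where "0 \<le> t" "0 \<le> t'" "u = t *\<^sub>R a + s *\<^sub>R h" "b = t * norm a"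
      "v = t' *\<^sub>R a + s' *\<^sub>R h" "c = t' * norm a"
      unfolding C_def by blast
    then show ?thesis using CI[of "t + t'" "s + s'"] by (simp add: algebra_simps)
  qed
  have scale: "(r *\<^sub>R u, r * b) \<in> C" if "(u, b) \<in> C" "0 < r" for u b r
  proof -
    from that(1) obtain t s where "0 \<le> t" "u = t *\<^sub>R a + s *\<^sub>R h" "b = t * norm a"
      unfolding C_def by blast
    then show ?thesis using CI[of "r * t" "r * s"] that(2) by (simp add: algebra_simps)
  qed
  have below: "b \<le> norm u" if "(u, b) \<in> C" for u b
  proof -
    from that obtain t s where t: "0 \<le> t" and u: "u = t *\<^sub>R a + s *\<^sub>R h" "b = t * norm a"
      unfolding C_def by blast
    show ?thesis
    proof (cases "t = 0")
      case False
      then have "u = t *\<^sub>R (a + (s / t) *\<^sub>R h)" by (simp add: u scaleR_right_distrib)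
      then have "norm u = t * norm (a + (s / t) *\<^sub>R h)" using t by simp
      then show ?thesis using mult_left_mono[OF orth t] by (simp add: u(2))
    qed (simp add: u)
  qed
  note cone = norm zero add scale below
  obtain f where f: "linear f" "\<And>z. f z \<le> cone_inf C norm z"
    using hahn_banach_sublinear[OF sublinear_cone_inf[of norm C]] cone by metis
  have minus: "b \<le> f u" if "(u, b) \<in> C" for u b
    using f(2)[of "- u"] cone_inf_minus_le[of norm C u b] cone that linear_neg[OF f(1), of u]
    by fastforce
  have le: "f z \<le> norm z" for z
    using f(2)[of z] cone_inf_le_self[of norm C z] cone by fastforce
  show ?thesis
  proof (rule that[OF f(1) le])
    show "f a = norm a"
      using le[of a] minus[OF CI[of 1 0]] by simp
    show "f h = 0"
      using minus[OF CI[of 0 1]] minus[OF CI[of 0 "- 1"]] linear_neg[OF f(1), of h] by simp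
  qed
qed

section \<open>States on Hilbert modules\<close>

lemma positive_scaleR:
  assumes "positive a" "0 \<le> r"
  shows "positive (r *\<^sub>R a)"
proof -
  obtain b where "a = cstar b * b" using assms by (auto simp: positive_def)
  then have "r *\<^sub>R a = cstar (sqrt r *\<^sub>R b) * (sqrt r *\<^sub>R b)"
    using assms by (simp add: cstar_scaleR)
  then show ?thesis unfolding positive_def by blast
qed

lemma positive_selfadjoint: "positive a \<Longrightarrow> cstar a = a"
  by (auto simp: positive_def cstar_mult cstar_cstar)

lemma is_state_norm_le:
  assumes "is_state \<phi>"
  shows "cmod (\<phi> z) \<le> norm z"
  using onorm[of \<phi> z] assms by (simp add: is_state_def)

text \<open>A norming functional \<open>f\<close> of a positive element is positive: by scaling let \<open>a\<close> and \<open>p\<close> be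
  positive of norm one; then \<open>1 - f p = f (a - p) \<le> \<parallel>a - p\<parallel> \<le> 1\<close>. Averaging \<open>f\<close> with
  \<open>f \<circ> cstar\<close> makes its complexification real on selfadjoint elements.\<close>

lemma state_exists:
  fixes a h :: "'a::cstar_algebra"
  assumes a: "positive a" "a \<noteq> 0" and h: "cstar h = h"
    and orth: "\<And>r. norm a \<le> norm (a + r *\<^sub>R h)"
  obtains \<phi> where "is_state \<phi>" "\<phi> a = norm a" "\<phi> h = 0"
proof -
  obtain f where f: "linear f" "\<And>z. f z \<le> norm z" "f a = norm a" "f h = 0"
    using norming_functional_vanishing_at[of a h] orth by blast
  define g where "g z = (f z + f (cstar z)) / 2" for z
  have g_add: "g (z + w) = g z + g w" for z w
    by (simp add: g_def cstar_add linear_add[OF f(1)] add_divide_distrib)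
  have g_scale: "g (r *\<^sub>R z) = r * g z" for r z
    by (simp add: g_def cstar_scaleR linear_cmul[OF f(1)] distrib_left)
  have g_diff: "g (z - w) = g z - g w" for z w
    using g_add[of z "(-1) *\<^sub>R w"] g_scale[of "-1" w] by simp
  have g_le: "g z \<le> norm z" for z
    using f(2)[of z] f(2)[of "cstar z"] by (simp add: g_def)
  have g_a: "g a = norm a" and g_h: "g h = 0"
    by (simp_all add: g_def positive_selfadjoint a f h)
  \<comment> \<open>The involution fixes \<open>g\<close> but changes the sign of
    \<open>\<i> *\<^sub>C z\<close>.\<close>
  have g_i: "g (\<i> *\<^sub>C z) = 0" if "cstar z = z" for z
    using linear_neg[OF f(1), of "\<i> *\<^sub>C z"] by (simp add: g_def cstar_scaleC that)
  have g_scaleC: "g (c *\<^sub>C z) = Re c * g z + Im c * g (\<i> *\<^sub>C z)" for c z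
  proof -
    have "c *\<^sub>C z = (complex_of_real (Re c) + complex_of_real (Im c) * \<i>) *\<^sub>C z"
      by (metis complex_eq mult.commute)
    also have "\<dots> = Re c *\<^sub>R z + Im c *\<^sub>R (\<i> *\<^sub>C z)"
      by (simp add: scaleC_add_left scaleR_scaleC scaleC_scaleC)
    finally show ?thesis by (simp add: g_add g_scale)
  qed
  have g_pos: "0 \<le> g p" if p: "positive p" for p
  proof (cases "p = 0")
    case False
    define a' where "a' = inverse (norm a) *\<^sub>R a"
    define p' where "p' = inverse (norm p) *\<^sub>R p"
    have "positive a'" "positive p'" "norm a' = 1" "norm p' = 1" "g a' = 1"
      using a p False by (simp_all add: a'_def p'_def positive_scaleR g_scale g_a)
    then have "0 \<le> g p'"
      using g_le[of "a' - p'"] norm_diff_positive_le[of a' p'] by (simp add: g_diff)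
    then show ?thesis
      using False by (simp add: p'_def g_scale zero_le_mult_iff)
  qed (use g_scale[of 0 0] in simp)
  \<comment> \<open>The complex-linear functional with real part \<open>g\<close>.\<close>
  define \<phi> where "\<phi> z = Complex (g z) (- g (\<i> *\<^sub>C z))" for z
  have add: "\<phi> (z + w) = \<phi> z + \<phi> w" for z w
    by (simp add: \<phi>_def scaleC_add_right g_add complex_eq_iff)
  have scale: "\<phi> (c *\<^sub>C z) = c * \<phi> z" for c z
    using g_scaleC[of c z] g_scaleC[of "\<i> * c" z]
    by (simp add: \<phi>_def scaleC_scaleC complex_eq_iff)
  have bound: "cmod (\<phi> z) \<le> norm z" for z
  proof (cases "\<phi> z = 0")
    case False
    \<comment> \<open>A phase rotating \<open>\<phi> z\<close> onto the positive real axis reduces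
      the bound to \<open>g_le\<close>.\<close>
    define w where "w = cnj (\<phi> z) / complex_of_real (cmod (\<phi> z))"
    have "w * \<phi> z = complex_of_real (cmod (\<phi> z))"
      using False complex_norm_square[of "\<phi> z"]
      by (simp add: w_def power2_eq_square field_simps)
    then have "cmod (\<phi> z) = Re (\<phi> (w *\<^sub>C z))" by (simp add: scale)
    also have "\<dots> \<le> norm (w *\<^sub>C z)" by (simp add: \<phi>_def g_le)
    also have "\<dots> = norm z" using False by (simp add: norm_scaleC w_def norm_divide)
    finally show ?thesis .
  qed simp
  have bl: "bounded_linear \<phi>"
    by (rule bounded_linear_intro[where K = 1])
       (simp_all add: add scaleR_scaleC[where 'a = 'a] scale bound scaleR_conv_of_real)
  have \<phi>_a: "\<phi> a = norm a"
    by (simp add: \<phi>_def complex_eq_iff g_a g_i positive_selfadjoint a)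
  have "onorm \<phi> = 1"
  proof (rule antisym)
    show "onorm \<phi> \<le> 1" by (rule onorm_bound) (simp_all add: bound)
    show "1 \<le> onorm \<phi>" using onorm[OF bl, of a] a by (simp add: \<phi>_a)
  qed
  then have "is_state \<phi>"
    using bl g_pos by (simp add: is_state_def add scale) (simp add: \<phi>_def g_i positive_selfadjoint)
  moreover have "\<phi> h = 0" by (simp add: \<phi>_def complex_eq_iff g_h g_i h)
  ultimately show ?thesis using \<phi>_a that by blast
qed

section \<open>Inner products and real orthogonality\<close>

context
  fixes rmul :: "'x::{complex_normed_vector,banach} \<Rightarrow> 'a::cstar_algebra \<Rightarrow> 'x"
    and ip :: "'x \<Rightarrow> 'x \<Rightarrow> 'a"
  assumes module: "hilbert_module rmul ip"
begin

lemma ip_add_right: "ip x (y + z) = ip x y + ip x z"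
  and ip_scaleC_right: "ip x (c *\<^sub>C y) = c *\<^sub>C ip x y"
  and cstar_ip: "cstar (ip x y) = ip y x"
  and ip_positive: "positive (ip x x)"
  and ip_eq_0_iff: "ip x x = 0 \<longleftrightarrow> x = 0"
  using module unfolding hilbert_module_def by blast+

lemma norm_ip_self: "norm (ip x x) = (norm x)\<^sup>2"
proof -
  have "norm x = sqrt (norm (ip x x))"
    using module unfolding hilbert_module_def by blast
  then show ?thesis by simp
qed

lemma ip_add_left: "ip (y + z) x = ip y x + ip z x"
  by (metis cstar_ip cstar_add ip_add_right)

lemma ip_scaleC_left: "ip (c *\<^sub>C y) x = cnj c *\<^sub>C ip y x"
  by (metis cstar_ip cstar_scaleC ip_scaleC_right)

lemma ip_line:
  "ip (x + r *\<^sub>R y) (x + r *\<^sub>R y) = ip x x + r *\<^sub>R (ip x y + ip y x) + r\<^sup>2 *\<^sub>R ip y y"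
  by (simp add: scaleR_scaleC ip_add_left ip_add_right ip_scaleC_left ip_scaleC_right
      scaleC_scaleC scaleC_add_right power2_eq_square)

text \<open>States are hermitian, but without a unit it is easier to read this off the positivity of
  \<open>\<phi> \<langle>x + i y, x + i y\<rangle>\<close>.\<close>

lemma state_Re_ip_commute:
  assumes "is_state \<phi>"
  shows "Re (\<phi> (ip y x)) = Re (\<phi> (ip x y))"
proof -
  have \<phi>: "\<phi> (a + b) = \<phi> a + \<phi> b" "\<phi> (c *\<^sub>C a) = c * \<phi> a" "Im (\<phi> (ip z z)) = 0" for a b c z
    using assms ip_positive[of z] by (auto simp: is_state_def)
  have "ip (x + \<i> *\<^sub>C y) (x + \<i> *\<^sub>C y)
      = ip x x + \<i> *\<^sub>C ip x y + (- \<i>) *\<^sub>C ip y x + ip (\<i> *\<^sub>C y) (\<i> *\<^sub>C y)"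
    by (simp only: ip_add_left ip_add_right ip_scaleC_left ip_scaleC_right complex_cnj_i add.assoc)
       (simp add: algebra_simps scaleC_diff_right)
  \<comment> \<open>The imaginary part of the image under \<open>\<phi>\<close> is
    \<open>Re (\<phi> (ip x y)) - Re (\<phi> (ip y x))\<close>.\<close>
  then show ?thesis
    using \<phi>(3)[of "x + \<i> *\<^sub>C y"] by (simp only: \<phi>(1,2)) (simp add: \<phi>(3))
qed

text \<open>The quadratic term is removed by convexity: along \<open>t h\<close> it contributes \<open>O(t\<^sup>2)\<close>, while the norm
  is bounded by its linear interpolation.\<close>

lemma norm_ip_le_of_birkhoff:
  assumes "birkhoff_orth_real x y"
  shows "norm (ip x x) \<le> norm (ip x x + r *\<^sub>R (ip x y + ip y x))"
proof -
  define a where "a = ip x x"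
  define h where "h = r *\<^sub>R (ip x y + ip y x)"
  define C where "C = r\<^sup>2 * norm (ip y y)"
  have bound: "norm a \<le> norm (a + h) + t * C" if t: "0 < t" "t \<le> 1" for t
  proof -
    have "(norm x)\<^sup>2 \<le> (norm (x + (t * r) *\<^sub>R y))\<^sup>2"
      using assms by (simp add: birkhoff_orth_real_def power_mono)
    then have "norm a \<le> norm (a + t *\<^sub>R h + (t * r)\<^sup>2 *\<^sub>R ip y y)"
      using ip_line[of x "t * r" y] by (simp add: a_def h_def flip: norm_ip_self)
    also have "a + t *\<^sub>R h = (1 - t) *\<^sub>R a + t *\<^sub>R (a + h)"
      by (simp add: algebra_simps)
    also have "norm (\<dots> + (t * r)\<^sup>2 *\<^sub>R ip y y)
        \<le> (1 - t) * norm a + t * norm (a + h) + (t * r)\<^sup>2 * norm (ip y y)"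
      using t by (intro norm_triangle_mono) auto
    finally have "t * norm a \<le> t * (norm (a + h) + t * C)"
      by (simp add: C_def algebra_simps power2_eq_square)
    then show ?thesis using t by simp
  qed
  have "norm a \<le> norm (a + h)"
  proof (rule tendsto_lowerbound)
    show "((\<lambda>t. norm (a + h) + t * C) \<longlongrightarrow> norm (a + h)) (at_right 0)"
      by (rule tendsto_eq_intros refl tendsto_ident_at | simp)+
    show "\<forall>\<^sub>F t in at_right 0. norm a \<le> norm (a + h) + t * C"
      using bound by (auto simp: eventually_at_right_field intro!: exI[of _ 1])
  qed simp
  then show ?thesis by (simp add: a_def h_def)
qed

end

theorem theorem3p1:
  fixes rmul :: "'x::{complex_normed_vector,banach} \<Rightarrow> 'a::cstar_algebra \<Rightarrow> 'x"
    and ip :: "'x \<Rightarrow> 'x \<Rightarrow> 'a"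
    and x y :: 'x
  assumes "hilbert_module rmul ip"
    and "\<exists>a::'a. a \<noteq> 0"
  shows "birkhoff_orth_real x y \<longleftrightarrow> (\<exists>\<phi>\<in>Omega ip x. Re (\<phi> (ip x y)) = 0)"
proof
  note module = assms(1)
  assume orth: "birkhoff_orth_real x y"
  have "\<exists>\<phi>. is_state \<phi> \<and> \<phi> (ip x x) = norm (ip x x) \<and> \<phi> (ip x y + ip y x) = 0"
  proof (cases "x = 0")
    \<comment> \<open>For \<open>x = 0\<close> any state will do. The zero algebra has none, since
      states have norm 1; a nonzero \<open>b\<close> provides one that norms
      \<open>cstar b * b\<close>.\<close>
    case True
    obtain b :: 'a where "b \<noteq> 0" using assms(2) by blast
    then have "positive (cstar b * b)" "cstar b * b \<noteq> 0"
      by (auto simp: positive_def cstar_mult_self_eq_0)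
    then obtain \<phi> where "is_state (\<phi> :: 'a \<Rightarrow> complex)" by (rule state_exists[where h = 0]) auto
    moreover from this have "\<phi> 0 = 0"
      using bounded_linear.linear linear_0 unfolding is_state_def by blast
    moreover have "ip 0 z = 0" "ip z 0 = 0" for z
      using ip_scaleC_right[OF module, of z 0 0] ip_scaleC_left[OF module, of 0 0 z] by simp_all
    ultimately show ?thesis using True by auto
  next
    case False
    show ?thesis
    proof (rule state_exists)
      show "positive (ip x x)" by (rule ip_positive[OF module])
      show "ip x x \<noteq> 0" using False by (simp add: ip_eq_0_iff[OF module])
      show "cstar (ip x y + ip y x) = ip x y + ip y x"
        by (simp add: cstar_add cstar_ip[OF module])
      show "norm (ip x x) \<le> norm (ip x x + r *\<^sub>R (ip x y + ip y x))" for r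
        by (rule norm_ip_le_of_birkhoff[OF module orth])
    qed blast
  qed
  then obtain \<phi> where \<phi>: "is_state \<phi>" "\<phi> (ip x x) = norm (ip x x)" "\<phi> (ip x y + ip y x) = 0"
    by blast
  \<comment> \<open>The two real parts add up to 0 and are equal, so both vanish.\<close>
  have "Re (\<phi> (ip x y)) + Re (\<phi> (ip y x)) = 0"
    using \<phi>(1,3) unfolding is_state_def by (metis plus_complex.sel(1) zero_complex.sel(1))
  then have "Re (\<phi> (ip x y)) = 0"
    using state_Re_ip_commute[OF module \<phi>(1), of y x] by simp
  moreover have "\<phi> \<in> Omega ip x"
    using \<phi> by (simp add: Omega_def states_def norm_ip_self[OF module])
  ultimately show "\<exists>\<phi>\<in>Omega ip x. Re (\<phi> (ip x y)) = 0" by blast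
next
  note module = assms(1)
  assume "\<exists>\<phi>\<in>Omega ip x. Re (\<phi> (ip x y)) = 0"
  then obtain \<phi> where st: "is_state \<phi>" and \<phi>x: "\<phi> (ip x x) = (norm x)\<^sup>2"
    and re: "Re (\<phi> (ip x y)) = 0"
    by (auto simp: Omega_def states_def)
  have lin: "\<phi> (a + b) = \<phi> a + \<phi> b" "\<phi> (r *\<^sub>R a) = r * \<phi> a" for a b r
    using st by (auto simp: is_state_def scaleR_scaleC)
  show "birkhoff_orth_real x y"
    unfolding birkhoff_orth_real_def
  proof
    fix r :: real
    have "0 \<le> Re (\<phi> (ip y y))"
      using st ip_positive[OF module, of y] by (auto simp: is_state_def)
    \<comment> \<open>The term linear in \<open>r\<close> has real part
      \<open>2 * r * Re (\<phi> (ip x y)) = 0\<close>, and the quadratic term is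
      non-negative.\<close>
    then have "(norm x)\<^sup>2 \<le> Re (\<phi> (ip (x + r *\<^sub>R y) (x + r *\<^sub>R y)))"
      unfolding ip_line[OF module] lin
      using re state_Re_ip_commute[OF module st, of y x] by (simp add: \<phi>x)
    also have "\<dots> \<le> (norm (x + r *\<^sub>R y))\<^sup>2"
      using complex_Re_le_cmod is_state_norm_le[OF st] order_trans
      by (fastforce simp flip: norm_ip_self[OF module])
    finally show "norm x \<le> norm (x + r *\<^sub>R y)" by (rule power2_le_imp_le) simp
  qed
qed

end
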